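(* Let $s\in(0,1)$ and let $\Omega\subseteq\mathbb{R}^n$ be a bounded open set with boundary of class $C^1$. Let $u_0$ be the principal eigenfunction of $\mathcal{L}$ in $\Omega$. Then $u_0$ is globally bounded on $\Omega$, i.e. $u_0\in L^\infty(\Omega)$.
   Context: $\mathcal{L}=-\Delta+(-\Delta)^s$. Let $\mathbb{X}(\Omega):=\{u\in H^1(\mathbb{R}^n): u\equiv 0 \text{ a.e. on } \mathbb{R}^n\setminus\Omega\}$ and for $u\in\mathbb{X}(\Omega)$ $$\mathcal{D}_{\Omega,s}(u):=\int_\Omega|\nabla u|^2\,dx+\iint_{\mathbb{R}^{2n}}\frac{|u(x)-u(y)|^2}{|x-y|^{n+2s}}\,dx\,dy,\qquad \lambda_{\mathcal{L}}(\Omega):=\inf_{u\in\mathbb{X}(\Omega)\setminus\{0\}}\frac{\mathcal{D}_{\Omega,s}(u)}{\|u\|^2_{L^2(\Omega)}}.$$ The principal eigenfunction $u_0$ is the (unique) function $u_0\in\mathbb{X}(\Omega)$ with $\|u_0\|_{L^2(\Omega)}=1$, $\mathcal{D}_{\Omega,s}(u_0)=\lambda_{\mathcal{L}}(\Omega)$ and $u_0\ge0$ a.e. in $\Omega$; it satisfies, for every $v\in\mathbb{X}(\Omega)$, $$\int_\Omega\langle\nabla u_0,\nabla v\rangle\,dx+\iint_{\mathbb{R}^{2n}}\frac{(u_0(x)-u_0(y))(v(x)-v(y))}{|x-y|^{n+2s}}\,dx\,dy=\lambda_{\mathcal{L}}(\Omega)\int_{\mathbb{R}^n}u_0v\,dx.$$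 *)

theory Defs
  imports "HOL-Analysis.Analysis"
begin

fun Ck :: "nat \<Rightarrow> ('a::euclidean_space \<Rightarrow> real) \<Rightarrow> bool" where
  "Ck 0 f = continuous_on UNIV f"
| "Ck (Suc k) f = (\<exists>g. (\<forall>x. (f has_derivative (\<lambda>h. g x \<bullet> h)) (at x))
                       \<and> (\<forall>b\<in>Basis. Ck k (\<lambda>x. g x \<bullet> b)))"

definition smooth_fun :: "('a::euclidean_space \<Rightarrow> real) \<Rightarrow> bool" where
  "smooth_fun f \<longleftrightarrow> (\<forall>k. Ck k f)"

definition test_fun :: "('a::euclidean_space \<Rightarrow> real) \<Rightarrow> bool" where
  "test_fun \<phi> \<longleftrightarrow> smooth_fun \<phi> \<and> compact (closure {x. \<phi> x \<noteq> 0})"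

definition weak_gradient :: "('a::euclidean_space \<Rightarrow> real) \<Rightarrow> ('a \<Rightarrow> 'a) \<Rightarrow> bool" where
  "weak_gradient u g \<longleftrightarrow>
     (\<forall>\<phi> d\<phi>. test_fun \<phi> \<and> (\<forall>x. (\<phi> has_derivative (\<lambda>h. d\<phi> x \<bullet> h)) (at x)) \<longrightarrow>
        (\<forall>b\<in>Basis. (\<integral>x. u x * (d\<phi> x \<bullet> b) \<partial>lebesgue) = - (\<integral>x. (g x \<bullet> b) * \<phi> x \<partial>lebesgue)))"

definition L2_grad :: "('a::euclidean_space \<Rightarrow> real) \<Rightarrow> ('a \<Rightarrow> 'a) \<Rightarrow> bool" where
  "L2_grad u g \<longleftrightarrow> g \<in> borel_measurable lebesgue \<and> integrable lebesgue (\<lambda>x. (norm (g x))\<^sup>2)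
                   \<and> weak_gradient u g"

definition H1 :: "('a::euclidean_space \<Rightarrow> real) set" where
  "H1 = {u. u \<in> borel_measurable lebesgue \<and> integrable lebesgue (\<lambda>x. (u x)\<^sup>2) \<and> (\<exists>g. L2_grad u g)}"

text \<open>The weak gradient (unique up to null sets).\<close>
definition wgrad :: "('a::euclidean_space \<Rightarrow> real) \<Rightarrow> 'a \<Rightarrow> 'a" where
  "wgrad u = (SOME g. L2_grad u g)"

definition XOmega :: "'a::euclidean_space set \<Rightarrow> ('a \<Rightarrow> real) set" where
  "XOmega \<Omega> = {u \<in> H1. AE x in lebesgue. x \<notin> \<Omega> \<longrightarrow> u x = 0}"

definition Denergy :: "'a::euclidean_space set \<Rightarrow> real \<Rightarrow> ('a \<Rightarrow> real) \<Rightarrow> ennreal" where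
  "Denergy \<Omega> s u =
     (\<integral>\<^sup>+ x. indicator \<Omega> x * ennreal ((norm (wgrad u x))\<^sup>2) \<partial>lebesgue)
   + (\<integral>\<^sup>+ x. \<integral>\<^sup>+ y. ennreal ((u x - u y)\<^sup>2 / dist x y powr (real DIM('a) + 2 * s)) \<partial>lebesgue \<partial>lebesgue)"

definition L2sq_on :: "'a::euclidean_space set \<Rightarrow> ('a \<Rightarrow> real) \<Rightarrow> real" where
  "L2sq_on \<Omega> u = (\<integral>x. indicator \<Omega> x * (u x)\<^sup>2 \<partial>lebesgue)"

definition lambdaL :: "'a::euclidean_space set \<Rightarrow> real \<Rightarrow> ennreal" where
  "lambdaL \<Omega> s = (INF u \<in> {u \<in> XOmega \<Omega>. \<not> (AE x in lebesgue. u x = 0)}.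
                     Denergy \<Omega> s u / ennreal (L2sq_on \<Omega> u))"

text \<open>Principal eigenfunction of L = -Laplacian + (-Laplacian)^s.\<close>
definition principal_eigenfunction :: "'a::euclidean_space set \<Rightarrow> real \<Rightarrow> ('a \<Rightarrow> real) \<Rightarrow> bool" where
  "principal_eigenfunction \<Omega> s u \<longleftrightarrow>
     u \<in> XOmega \<Omega> \<and> L2sq_on \<Omega> u = 1 \<and> Denergy \<Omega> s u = lambdaL \<Omega> s
     \<and> (AE x in lebesgue. x \<in> \<Omega> \<longrightarrow> u x \<ge> 0)"

definition C1_fun :: "('a::euclidean_space \<Rightarrow> real) \<Rightarrow> bool" where
  "C1_fun \<gamma> \<longleftrightarrow> (\<exists>g. continuous_on UNIV g \<and> (\<forall>x. (\<gamma> has_derivative (\<lambda>h. g x \<bullet> h)) (at x)))"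

text \<open>Boundary of class C^1: near each boundary point, after a rotation putting the
  unit vector e in the role of the last axis, Omega is the supergraph of a C^1 function
  of the remaining coordinates (the projection onto the orthogonal complement of e).\<close>
definition C1_boundary :: "'a::euclidean_space set \<Rightarrow> bool" where
  "C1_boundary \<Omega> \<longleftrightarrow>
     (\<forall>x0\<in>frontier \<Omega>. \<exists>r>0. \<exists>e \<gamma>. norm e = 1 \<and> C1_fun \<gamma> \<and>
        \<Omega> \<inter> ball x0 r = {x \<in> ball x0 r. x \<bullet> e > \<gamma> (x - (x \<bullet> e) *\<^sub>R e)})"

end

theory Submission
  imports Defs "HOL-Computational_Algebra.Polynomial"
begin

text \<open>
  Write \<open>N\<close> for the nonlocal part of the energy. The function \<open>v = min u k\<close> is an admissible competitor
  whose weak gradient is dominated by that of \<open>u\<close>, and for \<open>w = u - v\<close> one has \<open>N v + N w \<le> N u\<close> because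
  \<open>v\<close> and \<open>w\<close> are nondecreasing functions of \<open>u\<close>. Minimality of \<open>u\<close> therefore gives
  \<open>N w \<le> \<lambda> (\<integral> u\<^sup>2 - \<integral> v\<^sup>2)\<close>. The nonlocal term alone controls \<open>\<integral> w\<^sup>2\<close> by \<open>|{u > k}|\<^bsup>2s/n\<^esup> N w\<close>,
  so no Sobolev inequality is needed, and De Giorgi's iteration over the levels \<open>K (2 - 2\<^bsup>-j\<^esup>)\<close> yields
  \<open>|{u > 2K}| = 0\<close> for large \<open>K\<close>.

  The chain rule for \<open>min u k\<close> is obtained from the identity
  \<open>u (x + t b) - u x = t \<integral>\<^sub>0\<^sup>1 g (x + \<sigma> t b) \<bullet> b d\<sigma>\<close>, valid for almost every \<open>x\<close>.
\<close>

section \<open>Smooth functions and cut-offs\<close>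

text \<open>\<open>principal_eigenfunction\<close> records minimality only, so competitors are
  compared directly and no Euler-Lagrange equation is derived. Since the gradient term of the
  truncation is at most that of \<open>u\<close>, it can be discarded, and only the nonlocal term
  has to do quantitative work. Two features of the definitions shape the rest. \<open>wgrad\<close>
  is a Hilbert choice, so the gradient of a truncation is reached only through almost everywhere
  uniqueness; that in turn needs a rich supply of functions satisfying \<open>test_fun\<close>,
  built here from exp(-1/t). Energies are extended nonnegative reals, so the comparison can be
  cancelled only once the eigenvalue is known to be finite. The bound on N w still contains, besides
  w^2, the term 2 k w. On level sets of small measure the constant of the nonlocal inequality
  exceeds four times the eigenvalue; Young's inequality then absorbs everything quadratic in w and
  leaves k^2 |{u > k}|^(1 + 4s/n). The exponent above one is what drives the iteration.\<close>

lemma Ck_Suc_imp_Ck: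
  fixes f :: "'a::euclidean_space \<Rightarrow> real"
  shows "Ck (Suc k) f \<Longrightarrow> Ck k f"
proof (induction k arbitrary: f)
  case 0
  then show ?case
    by (auto intro!: continuous_at_imp_continuous_on intro: has_derivative_continuous)
next
  case (Suc k)
  from Suc.prems obtain g where g: "\<forall>x. (f has_derivative (\<lambda>h. g x \<bullet> h)) (at x)"
     "\<forall>b\<in>Basis. Ck (Suc k) (\<lambda>x. g x \<bullet> b)" by (subst (asm) Ck.simps(2)) blast
  with Suc.IH show ?case by (subst Ck.simps(2)) blast
qed

lemma Ck_const: "Ck k (\<lambda>x::'a::euclidean_space. c)"
proof (induction k arbitrary: c)
  case (Suc k)
  then show ?case by (auto intro!: exI[of _ "\<lambda>_. 0"] derivative_eq_intros)
qed auto

lemma Ck_add: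
  fixes f g :: "'a::euclidean_space \<Rightarrow> real"
  shows "Ck k f \<Longrightarrow> Ck k g \<Longrightarrow> Ck k (\<lambda>x. f x + g x)"
proof (induction k arbitrary: f g)
  case (Suc k)
  from Suc.prems obtain f' g' where
    *: "\<forall>x. (f has_derivative (\<lambda>h. f' x \<bullet> h)) (at x)" "\<forall>b\<in>Basis. Ck k (\<lambda>x. f' x \<bullet> b)"
       "\<forall>x. (g has_derivative (\<lambda>h. g' x \<bullet> h)) (at x)" "\<forall>b\<in>Basis. Ck k (\<lambda>x. g' x \<bullet> b)" by auto
  have "((\<lambda>x. f x + g x) has_derivative (\<lambda>h. (f' x + g' x) \<bullet> h)) (at x)" for x
    using has_derivative_add[of f "\<lambda>h. f' x \<bullet> h" "at x" g "\<lambda>h. g' x \<bullet> h"] *(1,3)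
    by (simp add: inner_add_left)
  moreover have "\<forall>b\<in>Basis. Ck k (\<lambda>x. (f' x + g' x) \<bullet> b)"
    using Suc.IH *(2,4) by (auto simp: inner_add_left)
  ultimately show ?case by (auto intro!: exI[of _ "\<lambda>x. f' x + g' x"])
qed (auto intro: continuous_on_add)

lemma Ck_mult:
  fixes f g :: "'a::euclidean_space \<Rightarrow> real"
  shows "Ck k f \<Longrightarrow> Ck k g \<Longrightarrow> Ck k (\<lambda>x. f x * g x)"
proof (induction k arbitrary: f g)
  case (Suc k)
  \<comment> \<open>The product rule pairs each derivative with the other factor itself, so the
    factors have to be lowered by one class too.\<close>
  note lower = Suc.prems[THEN Ck_Suc_imp_Ck]
  from Suc.prems obtain f' g' where
    *: "\<forall>x. (f has_derivative (\<lambda>h. f' x \<bullet> h)) (at x)" "\<forall>b\<in>Basis. Ck k (\<lambda>x. f' x \<bullet> b)"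
       "\<forall>x. (g has_derivative (\<lambda>h. g' x \<bullet> h)) (at x)" "\<forall>b\<in>Basis. Ck k (\<lambda>x. g' x \<bullet> b)" by auto
  have "((\<lambda>x. f x * g x) has_derivative (\<lambda>h. (f x *\<^sub>R g' x + g x *\<^sub>R f' x) \<bullet> h)) (at x)" for x
    using has_derivative_mult[of f "\<lambda>h. f' x \<bullet> h" x UNIV g "\<lambda>h. g' x \<bullet> h"] *(1,3)
    by (simp add: inner_add_left mult.commute)
  moreover have "\<forall>b\<in>Basis. Ck k (\<lambda>x. (f x *\<^sub>R g' x + g x *\<^sub>R f' x) \<bullet> b)"
    using Suc.IH[OF lower(1)] Suc.IH[OF lower(2)] *(2,4) by (auto simp: inner_add_left intro!: Ck_add)
  ultimately show ?case by (auto intro!: exI[of _ "\<lambda>x. f x *\<^sub>R g' x + g x *\<^sub>R f' x"])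
qed (auto intro: continuous_on_mult)

lemma Ck_prod:
  fixes f :: "'i \<Rightarrow> 'a::euclidean_space \<Rightarrow> real"
  assumes "\<And>i. i \<in> I \<Longrightarrow> Ck k (f i)"
  shows "Ck k (\<lambda>x. \<Prod>i\<in>I. f i x)"
  using assms by (induction I rule: infinite_finite_induct) (auto intro: Ck_const Ck_mult)

lemma Ck_translate:
  fixes f :: "'a::euclidean_space \<Rightarrow> real"
  shows "Ck k f \<Longrightarrow> Ck k (\<lambda>x. f (x - c))"
proof (induction k arbitrary: f)
  case 0
  then show ?case by (auto intro!: continuous_on_compose2[of UNIV f] continuous_intros)
next
  case (Suc k)
  from Suc.prems obtain f' where
    *: "\<forall>x. (f has_derivative (\<lambda>h. f' x \<bullet> h)) (at x)" "\<forall>b\<in>Basis. Ck k (\<lambda>x. f' x \<bullet> b)" by auto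
  have "((\<lambda>x. f (x - c)) has_derivative (\<lambda>h. f' (x - c) \<bullet> h)) (at x)" for x
    by (rule has_derivative_compose[of "\<lambda>x. x - c" "\<lambda>h. h" x UNIV f, simplified])
       (auto intro!: derivative_eq_intros simp: *)
  moreover have "\<forall>b\<in>Basis. Ck k (\<lambda>x. f' (x - c) \<bullet> b)" using Suc.IH *(2) by auto
  ultimately show ?case by (auto intro!: exI[of _ "\<lambda>x. f' (x - c)"])
qed

section \<open>Flat exponentials and smooth bumps supported in boxes\<close>

text \<open>The polynomial in 1/t is carried along so that the family is closed under
  differentiation; \<open>p = 1\<close> is the classical smooth function exp(-1/t) extended by
  zero.\<close>

definition flat_exp :: "real poly \<Rightarrow> real \<Rightarrow> real" where
  "flat_exp p t = (if t \<le> 0 then 0 else poly p (1 / t) * exp (- 1 / t))"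

lemma poly_exp_neg_tendsto_0: "((\<lambda>y::real. poly p y * exp (- y)) \<longlongrightarrow> 0) at_top"
proof -
  have "((\<lambda>y. \<Sum>i\<le>degree p. coeff p i * (y ^ i / exp y)) \<longlongrightarrow> (\<Sum>i\<le>degree p. coeff p i * 0)) at_top"
    by (intro tendsto_sum tendsto_mult tendsto_const tendsto_power_div_exp_0)
  then show ?thesis
    by (simp add: poly_altdef sum_distrib_right exp_minus divide_inverse mult.assoc)
qed

lemma flat_exp_tendsto_0: "(flat_exp p \<longlongrightarrow> 0) (at 0)"
proof -
  have "((\<lambda>t. poly p (inverse t) * exp (- inverse t)) \<longlongrightarrow> 0) (at_right 0)"
    using filterlim_compose[OF poly_exp_neg_tendsto_0 filterlim_inverse_at_top_right, of p] by simp
  moreover have "eventually (\<lambda>t. poly p (inverse t) * exp (- inverse t) = flat_exp p t) (at_right 0)"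
    by (auto simp: eventually_at_filter flat_exp_def divide_inverse)
  ultimately have r: "(flat_exp p \<longlongrightarrow> 0) (at_right 0)" by (rule Lim_transform_eventually)
  have "eventually (\<lambda>t. 0 = flat_exp p t) (at_left 0)"
    by (auto simp: eventually_at_filter flat_exp_def)
  then have "(flat_exp p \<longlongrightarrow> 0) (at_left 0)" by (rule Lim_transform_eventually[rotated]) simp
  with r show ?thesis by (simp add: filterlim_split_at)
qed

text \<open>With y = 1/t one has dy/dt = -y^2, so p(y) exp(-y) has derivative y^2 (p(y) - p'(y))
  exp(-y); the polynomial \<open>[:0,0,1:]\<close> is the factor y^2.\<close>

lemma flat_exp_has_derivative:
  "(flat_exp p has_real_derivative flat_exp ([:0,0,1:] * (p - pderiv p)) t) (at t)"
proof -
  consider "t < 0" | "t = 0" | "t > 0" by linarith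
  then show ?thesis
  proof cases
    case 1
    have "((\<lambda>_. 0) has_real_derivative 0) (at t)" by simp
    then have "(flat_exp p has_real_derivative 0) (at t)"
      by (rule has_field_derivative_transform_within_open[of _ _ _ "{..<0}"]) (use 1 in \<open>auto simp: flat_exp_def\<close>)
    with 1 show ?thesis by (simp add: flat_exp_def)
  next
    case 2
    \<comment> \<open>Dividing by h multiplies the polynomial by its variable, so the difference
      quotient at 0 is again a flat exponential and tends to 0.\<close>
    have "flat_exp p h / h = flat_exp (pCons 0 p) h" for h
      by (auto simp: flat_exp_def)
    then show ?thesis using flat_exp_tendsto_0[of "pCons 0 p"]
      unfolding 2 DERIV_def by (simp add: flat_exp_def[of _ 0])
  next
    case 3
    have "((\<lambda>t. poly p (1 / t) * exp (- 1 / t)) has_real_derivative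
           flat_exp ([:0,0,1:] * (p - pderiv p)) t) (at t)"
      using 3 by (auto intro!: derivative_eq_intros DERIV_chain2[OF poly_DERIV]
         simp: flat_exp_def field_simps power2_eq_square)
    then show ?thesis
      by (rule has_field_derivative_transform_within_open[of _ _ _ "{0<..}"]) (use 3 in \<open>auto simp: flat_exp_def\<close>)
  qed
qed

lemma Ck_flat_exp_affine:
  fixes b :: "'a::euclidean_space"
  shows "Ck k (\<lambda>x. flat_exp p (\<alpha> + \<beta> * (x \<bullet> b)))"
proof (induction k arbitrary: p)
  case 0
  have "continuous_on UNIV (flat_exp p)"
    by (auto intro!: continuous_at_imp_continuous_on DERIV_isCont[OF flat_exp_has_derivative])
  then show ?case by (auto intro!: continuous_on_compose2[of UNIV "flat_exp p"] continuous_intros)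
next
  case (Suc k)
  define q where "q = [:0,0,1:] * (p - pderiv p)"
  define g where "g x = (flat_exp q (\<alpha> + \<beta> * (x \<bullet> b)) * \<beta>) *\<^sub>R b" for x
  have "((\<lambda>x. flat_exp p (\<alpha> + \<beta> * (x \<bullet> b))) has_derivative (\<lambda>h. g x \<bullet> h)) (at x)" for x
  proof -
    have "((\<lambda>x. \<alpha> + \<beta> * (x \<bullet> b)) has_derivative (\<lambda>h. \<beta> * (h \<bullet> b))) (at x)"
      by (auto intro!: derivative_eq_intros)
    from has_derivative_compose[OF this flat_exp_has_derivative[of p, folded q_def, unfolded has_field_derivative_def]]
    show ?thesis by (simp add: g_def inner_commute mult_ac)
  qed
  moreover have "\<forall>b'\<in>Basis. Ck k (\<lambda>x. g x \<bullet> b')"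
    using Suc.IH[of q] by (auto simp: g_def intro!: Ck_mult Ck_const)
  ultimately show ?case by auto
qed

text \<open>The factor \<open>Suc m\<close> steepens the profile: exp(-1/(c t)) tends to 1 for t > 0
  as c grows. The bumps therefore approach the indicator of the open box without changing their
  support.\<close>

definition box_bump :: "'a::euclidean_space \<Rightarrow> 'a \<Rightarrow> nat \<Rightarrow> 'a \<Rightarrow> real" where
  "box_bump a d m x = (\<Prod>i\<in>Basis. flat_exp 1 (real (Suc m) * (x \<bullet> i - a \<bullet> i)) *
                                  flat_exp 1 (real (Suc m) * (d \<bullet> i - x \<bullet> i)))"

lemma box_bump_eq_0: "x \<notin> box a d \<Longrightarrow> box_bump a d m x = 0"
  unfolding box_bump_def by (rule prod_zero) (auto simp: mem_box flat_exp_def mult_le_0_iff not_less)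

lemma box_bump_pos: "x \<in> box a d \<Longrightarrow> box_bump a d m x > 0"
  unfolding box_bump_def by (rule prod_pos) (auto simp: mem_box flat_exp_def mult_le_0_iff)

lemma box_bump_bounds: "0 \<le> box_bump a d m x" "box_bump a d m x \<le> 1"
proof -
  have *: "0 \<le> flat_exp 1 t" "flat_exp 1 t \<le> 1" for t by (auto simp: flat_exp_def)
  show "0 \<le> box_bump a d m x" "box_bump a d m x \<le> 1"
    unfolding box_bump_def using * by (auto intro!: prod_nonneg prod_le_1 mult_le_one)
qed

lemma box_bump_tendsto: "(\<lambda>m. box_bump a d m x) \<longlonglongrightarrow> indicator (box a d) x"
proof (cases "x \<in> box a d")
  case True
  have fe: "(\<lambda>m. flat_exp 1 (real (Suc m) * t)) \<longlonglongrightarrow> 1" if "t > 0" for t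
  proof -
    have "(\<lambda>m. exp (- (1 / t) * inverse (real (Suc m)))) \<longlonglongrightarrow> exp (- (1 / t) * 0)"
      by (intro tendsto_intros LIMSEQ_inverse_real_of_nat)
    moreover have "exp (- (1 / t) * inverse (real (Suc m))) = flat_exp 1 (real (Suc m) * t)" for m
      using that by (auto simp: flat_exp_def divide_inverse mult_le_0_iff mult_ac)
    ultimately show ?thesis by simp
  qed
  have "(\<lambda>m. box_bump a d m x) \<longlonglongrightarrow> (\<Prod>i\<in>(Basis::'a set). 1 * 1)"
    unfolding box_bump_def using True by (intro tendsto_prod tendsto_mult fe) (auto simp: mem_box)
  with True show ?thesis by simp
qed (simp add: box_bump_eq_0)

lemma test_fun_box_bump: "test_fun (box_bump a d m)"
proof -
  have "Ck k (box_bump a d m)" for k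
  proof -
    have "Ck k (\<lambda>x. flat_exp 1 (real (Suc m) * (x \<bullet> i - a \<bullet> i)) *
                    flat_exp 1 (real (Suc m) * (d \<bullet> i - x \<bullet> i)))" for i
      using Ck_flat_exp_affine[of k 1 "- real (Suc m) * (a \<bullet> i)" "real (Suc m)" i]
            Ck_flat_exp_affine[of k 1 "real (Suc m) * (d \<bullet> i)" "- real (Suc m)" i]
      by (intro Ck_mult) (simp_all only: right_diff_distrib diff_conv_add_uminus distrib_left mult_minus_left mult_minus_right add.commute)
    then show ?thesis unfolding box_bump_def by (intro Ck_prod)
  qed
  moreover have "closure {x. box_bump a d m x \<noteq> 0} \<subseteq> cbox a d"
    using box_bump_eq_0[of _ a d m] box_subset_cbox[of a d] by (intro closure_minimal) auto
  then have "compact (closure {x. box_bump a d m x \<noteq> 0})"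
    by (metis bounded_cbox bounded_subset closed_closure compact_eq_bounded_closed)
  ultimately show ?thesis by (simp add: test_fun_def smooth_fun_def)
qed

section \<open>Translates, bounds and measurability of test functions\<close>

lemma test_fun_translate:
  assumes "test_fun \<phi>" shows "test_fun (\<lambda>x. \<phi> (x - c))"
proof -
  have "{x. \<phi> (x - c) \<noteq> 0} = (+) c ` {x. \<phi> x \<noteq> 0}"
    by (auto simp: image_iff intro!: exI[of _ "x - c" for x])
  then have "closure {x. \<phi> (x - c) \<noteq> 0} = (+) c ` closure {x. \<phi> x \<noteq> 0}"
    by (simp add: closure_translation)
  with assms show ?thesis
    by (auto simp: test_fun_def smooth_fun_def intro!: Ck_translate compact_translation)
qed

lemma test_fun_gradientE:
  fixes \<phi> :: "'a::euclidean_space \<Rightarrow> real"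
  assumes "test_fun \<phi>"
  obtains d\<phi> R M where "\<And>x. (\<phi> has_derivative (\<lambda>h. d\<phi> x \<bullet> h)) (at x)" "continuous_on UNIV d\<phi>"
    "continuous_on UNIV \<phi>" "R > 0" "M > 0"
    "\<And>x. norm x \<ge> R \<Longrightarrow> \<phi> x = 0" "\<And>x. norm x \<ge> R \<Longrightarrow> d\<phi> x = 0"
    "\<And>x. \<bar>\<phi> x\<bar> \<le> M" "\<And>x. norm (d\<phi> x) \<le> M" "\<And>x y. \<bar>\<phi> x - \<phi> y\<bar> \<le> M * norm (x - y)"
proof -
  define S where "S = closure {x. \<phi> x \<noteq> 0}"
  have "Ck (Suc 0) \<phi>" "compact S" using assms by (auto simp: test_fun_def smooth_fun_def S_def)
  then obtain d\<phi> where d: "\<And>x. (\<phi> has_derivative (\<lambda>h. d\<phi> x \<bullet> h)) (at x)"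
      and c: "\<And>b. b \<in> Basis \<Longrightarrow> continuous_on UNIV (\<lambda>x. d\<phi> x \<bullet> b)" by auto
  have cd: "continuous_on UNIV d\<phi>" using c by (subst continuous_on_componentwise) auto
  have cp: "continuous_on UNIV \<phi>"
    using d by (auto intro!: continuous_at_imp_continuous_on intro: has_derivative_continuous)
  have z: "\<phi> x = 0" "d\<phi> x = 0" if "x \<notin> S" for x
  proof -
    have 0: "\<phi> x = 0" if "x \<notin> S" for x using that closure_subset[of "{x. \<phi> x \<noteq> 0}"] by (auto simp: S_def)
    show "\<phi> x = 0" using 0 that .
    have "(\<phi> has_derivative (\<lambda>h. 0)) (at x)"
      by (rule has_derivative_transform_within_open[of "\<lambda>_. 0" _ _ _ "- S"])
         (use that 0 in \<open>simp_all add: open_Compl compact_imp_closed \<open>compact S\<close>\<close>)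
    with d have "(\<lambda>h. d\<phi> x \<bullet> h) = (\<lambda>h. 0)" using has_derivative_unique by blast
    then have "d\<phi> x \<bullet> d\<phi> x = 0" by meson
    then show "d\<phi> x = 0" by simp
  qed
  obtain R where R: "R > 0" "\<forall>x\<in>S. norm x < R"
    using compact_imp_bounded[OF \<open>compact S\<close>] unfolding bounded_pos_less by auto
  have "bounded (\<phi> ` S)" "bounded (d\<phi> ` S)"
    using \<open>compact S\<close> cp cd
    by (auto intro!: compact_imp_bounded compact_continuous_image intro: continuous_on_subset)
  then obtain M1 M2 where M: "\<forall>x\<in>S. \<bar>\<phi> x\<bar> \<le> M1" "\<forall>x\<in>S. norm (d\<phi> x) \<le> M2" "M1 > 0" "M2 > 0"
    unfolding bounded_pos by auto
  define M where "M = max M1 M2"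
  have "M > 0" and b1: "\<bar>\<phi> x\<bar> \<le> M" and b2: "norm (d\<phi> x) \<le> M" for x
  proof -
    show "M > 0" "\<bar>\<phi> x\<bar> \<le> M" "norm (d\<phi> x) \<le> M"
      using M z[of x] by (cases "x \<in> S"; auto simp: M_def le_max_iff_disj less_max_iff_disj)+
  qed
  have "\<bar>\<phi> x - \<phi> y\<bar> \<le> M * norm (x - y)" for x y
  proof -
    have "norm (\<phi> x - \<phi> y) \<le> M * norm (x - y)"
    proof (rule differentiable_bound[of UNIV \<phi> "\<lambda>x h. d\<phi> x \<bullet> h"])
      show "onorm (\<lambda>h. d\<phi> x \<bullet> h) \<le> M" for x
      proof (rule onorm_bound)
        show "norm (d\<phi> x \<bullet> h) \<le> M * norm h" for h
          by (rule order_trans[OF Cauchy_Schwarz_ineq2[of "d\<phi> x" h, folded real_norm_def]])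
             (auto intro!: mult_right_mono b2)
      qed (use \<open>M > 0\<close> in auto)
    qed (auto simp: d)
    then show ?thesis by simp
  qed
  moreover have "x \<notin> S" if "norm x \<ge> R" for x using R(2) that by force
  ultimately show ?thesis using that[of d\<phi> R M] d cd cp R(1) z \<open>M > 0\<close> b1 b2 by blast
qed

text \<open>\<open>weak_gradient\<close> quantifies over an arbitrary \<open>d\<phi>\<close>
  representing the derivative. Uniqueness of derivatives identifies it with the continuous,
  compactly supported one supplied by \<open>Ck\<close>.\<close>

lemma test_fun_given_gradientE:
  fixes \<phi> :: "'a::euclidean_space \<Rightarrow> real"
  assumes t: "test_fun \<phi>" and d: "\<And>x. (\<phi> has_derivative (\<lambda>h. d\<phi> x \<bullet> h)) (at x)"
  obtains R M where "continuous_on UNIV d\<phi>" "continuous_on UNIV \<phi>" "R > 0" "M > 0"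
    "\<And>x. norm x \<ge> R \<Longrightarrow> \<phi> x = 0" "\<And>x. norm x \<ge> R \<Longrightarrow> d\<phi> x = 0"
    "\<And>x. \<bar>\<phi> x\<bar> \<le> M" "\<And>x. norm (d\<phi> x) \<le> M" "\<And>x y. \<bar>\<phi> x - \<phi> y\<bar> \<le> M * norm (x - y)"
proof -
  obtain d\<phi>' R M where *: "\<And>x. (\<phi> has_derivative (\<lambda>h. d\<phi>' x \<bullet> h)) (at x)"
    "continuous_on UNIV d\<phi>'" "continuous_on UNIV \<phi>" "R > 0" "M > 0"
    "\<And>x. norm x \<ge> R \<Longrightarrow> \<phi> x = 0" "\<And>x. norm x \<ge> R \<Longrightarrow> d\<phi>' x = 0"
    "\<And>x. \<bar>\<phi> x\<bar> \<le> M" "\<And>x. norm (d\<phi>' x) \<le> M" "\<And>x y. \<bar>\<phi> x - \<phi> y\<bar> \<le> M * norm (x - y)"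
    using t by (rule test_fun_gradientE) blast
  have "d\<phi>' = d\<phi>"
  proof
    fix x
    have "(\<lambda>h. d\<phi>' x \<bullet> h) = (\<lambda>h. d\<phi> x \<bullet> h)" using d *(1) has_derivative_unique by blast
    then show "d\<phi>' x = d\<phi> x" by (metis inner_commute vector_eq_ldot)
  qed
  with * that show ?thesis by blast
qed

lemma test_fun_measurable:
  fixes \<phi> :: "'a::euclidean_space \<Rightarrow> real"
  assumes "test_fun \<phi>" "\<And>x. (\<phi> has_derivative (\<lambda>h. d\<phi> x \<bullet> h)) (at x)"
  shows "\<phi> \<in> borel_measurable borel" "d\<phi> \<in> borel_measurable borel"
    "\<phi> \<in> borel_measurable lebesgue" "d\<phi> \<in> borel_measurable lebesgue"
proof -
  show "\<phi> \<in> borel_measurable borel" "d\<phi> \<in> borel_measurable borel"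
    by (rule test_fun_given_gradientE[OF assms], simp add: borel_measurable_continuous_onI)+
  then show "\<phi> \<in> borel_measurable lebesgue" "d\<phi> \<in> borel_measurable lebesgue"
    by (simp_all add: measurable_completion)
qed

section \<open>Square-integrable functions\<close>

lemma integrable_mult_L2:
  fixes f h :: "'a \<Rightarrow> real"
  assumes [measurable]: "f \<in> borel_measurable M" "h \<in> borel_measurable M"
    and "integrable M (\<lambda>x. (f x)\<^sup>2)" "integrable M (\<lambda>x. (h x)\<^sup>2)"
  shows "integrable M (\<lambda>x. f x * h x)"
proof (rule Bochner_Integration.integrable_bound[of _ "\<lambda>x. (f x)\<^sup>2 + (h x)\<^sup>2"])
  have "\<bar>a * b\<bar> \<le> a\<^sup>2 + b\<^sup>2" for a b :: real
  proof -
    have "0 \<le> (\<bar>a\<bar> - \<bar>b\<bar>)\<^sup>2" by simp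
    then have "2 * (\<bar>a\<bar> * \<bar>b\<bar>) \<le> a\<^sup>2 + b\<^sup>2" by (simp add: power2_diff)
    moreover have "0 \<le> \<bar>a\<bar> * \<bar>b\<bar>" by simp
    ultimately show ?thesis unfolding abs_mult by linarith
  qed
  then show "AE x in M. norm (f x * h x) \<le> norm ((f x)\<^sup>2 + (h x)\<^sup>2)" by simp
qed (use assms in auto)

lemma integrable_L2_add:
  fixes f h :: "'a \<Rightarrow> real"
  assumes [measurable]: "f \<in> borel_measurable M" "h \<in> borel_measurable M"
    and "integrable M (\<lambda>x. (f x)\<^sup>2)" "integrable M (\<lambda>x. (h x)\<^sup>2)"
  shows "integrable M (\<lambda>x. (f x + h x)\<^sup>2)"
  using assms integrable_mult_L2[OF assms] by (simp add: power2_sum mult.assoc)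

lemma integrable_L2_diff:
  fixes f h :: "'a \<Rightarrow> real"
  assumes [measurable]: "f \<in> borel_measurable M" "h \<in> borel_measurable M"
    and "integrable M (\<lambda>x. (f x)\<^sup>2)" "integrable M (\<lambda>x. (h x)\<^sup>2)"
  shows "integrable M (\<lambda>x. (f x - h x)\<^sup>2)"
  using integrable_L2_add[of f M "\<lambda>x. - h x"] assms by simp

lemma integrable_L2_dominated:
  fixes f h :: "'a \<Rightarrow> real"
  assumes "f \<in> borel_measurable M" "integrable M (\<lambda>x. (h x)\<^sup>2)" "\<And>x. \<bar>f x\<bar> \<le> \<bar>h x\<bar>"
  shows "integrable M (\<lambda>x. (f x)\<^sup>2)"
  by (rule Bochner_Integration.integrable_bound[OF assms(2)])
     (use assms in \<open>auto simp: abs_le_square_iff\<close>)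

lemma integrable_bounded_support:
  fixes \<phi> :: "'a::euclidean_space \<Rightarrow> real"
  assumes "\<phi> \<in> borel_measurable borel" "\<And>x. norm x \<ge> R \<Longrightarrow> \<phi> x = 0" "\<And>x. \<bar>\<phi> x\<bar> \<le> M"
  shows "integrable lborel (\<lambda>x. (\<phi> x)\<^sup>2)"
proof (rule Bochner_Integration.integrable_bound[of _ "\<lambda>x. indicator (ball 0 R) x * M\<^sup>2"])
  show "integrable lborel (\<lambda>x. indicator (ball (0::'a) R) x * M\<^sup>2)"
    using emeasure_bounded_finite[OF bounded_ball[of "0::'a" R]] by (intro integrable_mult_left integrable_real_indicator) auto
  have "(\<phi> x)\<^sup>2 \<le> M\<^sup>2" for x using assms(3)[of x] by (intro power2_le_iff_abs_le[THEN iffD2]) auto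
  then show "AE x in lborel. norm ((\<phi> x)\<^sup>2) \<le> norm (indicator (ball 0 R) x * M\<^sup>2)"
    using assms(2) by (auto simp: indicator_def not_less)
qed (use assms in auto)

lemma
  fixes f :: "'a::euclidean_space \<Rightarrow> real"
  assumes [measurable]: "f \<in> borel_measurable borel"
  shows integral_lborel_translate: "(\<integral>x. f (x + c) \<partial>lborel) = (\<integral>x. f x \<partial>lborel)"
    and integrable_lborel_translate: "integrable lborel (\<lambda>x. f (x + c)) \<longleftrightarrow> integrable lborel f"
proof -
  have "(\<integral>x. f x \<partial>distr lborel borel ((+) c)) = (\<integral>x. f (c + x) \<partial>lborel)"
    by (rule integral_distr) auto
  then show "(\<integral>x. f (x + c) \<partial>lborel) = (\<integral>x. f x \<partial>lborel)"
    by (simp add: lborel_distr_plus add.commute)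
  have "integrable (distr lborel borel ((+) c)) f \<longleftrightarrow> integrable lborel (\<lambda>x. f (c + x))"
    by (rule integrable_distr_eq) auto
  then show "integrable lborel (\<lambda>x. f (x + c)) \<longleftrightarrow> integrable lborel f"
    by (simp add: lborel_distr_plus add.commute)
qed

lemma nn_integral_lborel_translate:
  fixes f :: "'a::euclidean_space \<Rightarrow> ennreal"
  assumes [measurable]: "f \<in> borel_measurable borel"
  shows "(\<integral>\<^sup>+x. f (x + c) \<partial>lborel) = (\<integral>\<^sup>+x. f x \<partial>lborel)"
proof -
  have "(\<integral>\<^sup>+x. f x \<partial>distr lborel borel ((+) c)) = (\<integral>\<^sup>+x. f (c + x) \<partial>lborel)"
    by (rule nn_integral_distr) auto
  then show ?thesis by (simp add: lborel_distr_plus add.commute)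
qed

section \<open>Uniqueness of weak gradients\<close>

text \<open>The Borel sets over which f integrates to zero form a Dynkin system, where the vanishing
  total integral handles complements. Boxes are an intersection-stable generator, so all Borel sets
  qualify, in particular those where f is positive or negative.\<close>

lemma AE_zero_if_box_integrals_zero:
  fixes f :: "'a::euclidean_space \<Rightarrow> real"
  assumes f: "integrable lborel f" and 0: "\<And>a b. (\<integral>x. indicator (box a b) x * f x \<partial>lborel) = 0"
    and u: "(\<integral>x. f x \<partial>lborel) = 0"
  shows "AE x in lborel. f x = 0"
proof -
  have [measurable]: "f \<in> borel_measurable borel" using f by auto
  have si: "integrable lborel (\<lambda>x. indicator A x * f x)" if "A \<in> sets borel" for A
    using integrable_mult_indicator[of A lborel f] f that by simp
  have A: "(\<integral>x. indicator A x * f x \<partial>lborel) = 0" if "A \<in> sets borel" for A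
  proof -
    let ?G = "range (\<lambda>(a::'a, b). box a b)"
    have "Int_stable ?G" by (auto simp: Int_stable_def box_Int_box)
    moreover have "?G \<subseteq> Pow UNIV" by auto
    moreover have "A \<in> sigma_sets UNIV ?G" using that by (simp add: borel_eq_box)
    ultimately show ?thesis
    proof (induction rule: sigma_sets_induct_disjoint)
      case (compl A)
      then have [measurable]: "A \<in> sets borel" by (simp add: borel_eq_box)
      have "(\<integral>x. indicator (UNIV - A) x * f x \<partial>lborel) = (\<integral>x. f x - indicator A x * f x \<partial>lborel)"
        by (rule Bochner_Integration.integral_cong) (auto simp: indicator_def)
      also have "\<dots> = 0" using compl f si[of A] u by simp
      finally show ?case .
    next
      case (union A)
      then have [measurable]: "\<And>i. A i \<in> sets borel" by (auto simp: borel_eq_box)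
      have "(LINT x:(\<Union>i. A i)|lborel. f x) = (\<Sum>i. (LINT x:(A i)|lborel. f x))"
        by (rule lebesgue_integral_countable_add)
           (use union si[of "\<Union>i. A i"] in \<open>auto simp: disjoint_family_on_def set_integrable_def\<close>)
      with union show ?case by (simp add: set_lebesgue_integral_def)
    qed (use 0 in auto)
  qed
  have "AE x in lborel. indicator {x. f x > 0} x * f x = 0"
    using integral_nonneg_eq_0_iff_AE[OF si[of "{x. f x > 0}"]] A[of "{x. f x > 0}"]
    by (auto simp: indicator_def)
  moreover have "AE x in lborel. - (indicator {x. f x < 0} x * f x) = 0"
    using integral_nonneg_eq_0_iff_AE[OF integrable_minus[OF si[of "{x. f x < 0}"]]] A[of "{x. f x < 0}"]
    by (auto simp: indicator_def)
  ultimately show ?thesis by eventually_elim (auto simp: indicator_def split: if_splits)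
qed

text \<open>Testing with \<open>box_bump\<close> and letting it tend to the indicator of a box gives
  vanishing integrals over all boxes.\<close>

lemma fundamental_lemma_lborel:
  fixes f :: "'a::euclidean_space \<Rightarrow> real"
  assumes [measurable]: "f \<in> borel_measurable borel" and f2: "integrable lborel (\<lambda>x. (f x)\<^sup>2)"
    and 0: "\<And>\<phi>. test_fun \<phi> \<Longrightarrow> (\<integral>x. f x * \<phi> x \<partial>lborel) = 0"
  shows "AE x in lborel. f x = 0"
proof -
  have si: "integrable lborel (\<lambda>x. f x * indicator (box a b) x)" for a b
  proof (rule integrable_mult_L2)
    have "(\<lambda>x. (indicator (box a b) x)\<^sup>2) = (indicator (box a b) :: 'a \<Rightarrow> real)"
      by (auto simp: indicator_def)
    then show "integrable lborel (\<lambda>x. (indicator (box a b) x :: real)\<^sup>2)"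
      using integrable_real_indicator[of "box a b" lborel] emeasure_lborel_box_finite[of a b] by simp
  qed (use f2 in auto)
  have box0: "(\<integral>x. f x * indicator (box a b) x \<partial>lborel) = 0" for a b
  proof -
    have "(\<lambda>m. \<integral>x. f x * box_bump a b m x \<partial>lborel) \<longlonglongrightarrow> (\<integral>x. f x * indicator (box a b) x \<partial>lborel)"
    proof (rule integral_dominated_convergence[where w = "\<lambda>x. \<bar>f x * indicator (box a b) x\<bar>"])
      have "box_bump a b m \<in> borel_measurable borel" for m
        using test_fun_gradientE[OF test_fun_box_bump[of a b m]] borel_measurable_continuous_onI by blast
      then show "(\<lambda>x. f x * box_bump a b m x) \<in> borel_measurable lborel" for m by simp
      show "AE x in lborel. norm (f x * box_bump a b m x) \<le> \<bar>f x * indicator (box a b) x\<bar>" for m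
      proof (rule AE_I2)
        fix x show "norm (f x * box_bump a b m x) \<le> \<bar>f x * indicator (box a b) x\<bar>"
          using box_bump_bounds[of a b m x] box_bump_eq_0[of x a b m]
          by (cases "x \<in> box a b") (auto simp: abs_mult mult_left_le)
      qed
      show "AE x in lborel. (\<lambda>m. f x * box_bump a b m x) \<longlonglongrightarrow> f x * indicator (box a b) x"
        by (intro AE_I2 tendsto_mult tendsto_const box_bump_tendsto)
      show "integrable lborel (\<lambda>x. \<bar>f x * indicator (box a b) x\<bar>)" using si by auto
    qed auto
    then show ?thesis using 0[OF test_fun_box_bump] by (simp add: LIMSEQ_const_iff)
  qed
  \<comment> \<open>A square-integrable f need not be integrable, so the criterion is applied to its
    cut-off to a box; it stays applicable because two boxes intersect in a box. Countably many boxes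
    then exhaust the space.\<close>
  have "AE x in lborel. f x * indicator (box a b) x = 0" for a b
  proof (rule AE_zero_if_box_integrals_zero)
    fix c d
    have "(\<lambda>x. indicator (box c d) x * (f x * indicator (box a b) x)) =
          (\<lambda>x. f x * indicator (box c d \<inter> box a b) x)"
      by (auto simp: indicator_def)
    then show "(\<integral>x. indicator (box c d) x * (f x * indicator (box a b) x) \<partial>lborel) = 0"
      using box0 by (simp add: box_Int_box)
  qed (use si box0 in auto)
  then have "AE x in lborel. \<forall>n::nat. f x * indicator (box (- (real n *\<^sub>R One)) (real n *\<^sub>R One)) x = 0"
    by (subst AE_all_countable) blast
  then show ?thesis
  proof eventually_elim
    fix x assume *: "\<forall>n::nat. f x * indicator (box (- (real n *\<^sub>R One)) (real n *\<^sub>R One)) x = 0"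
    obtain n :: nat where "x \<in> box (- (real n *\<^sub>R One)) (real n *\<^sub>R One)"
      using UN_box_eq_UNIV[where 'a='a] by blast
    with spec[OF *, of n] show "f x = 0" by simp
  qed
qed

lemma fundamental_lemma:
  fixes f :: "'a::euclidean_space \<Rightarrow> real"
  assumes f: "f \<in> borel_measurable lebesgue" and f2: "integrable lebesgue (\<lambda>x. (f x)\<^sup>2)"
    and 0: "\<And>\<phi>. test_fun \<phi> \<Longrightarrow> (\<integral>x. f x * \<phi> x \<partial>lebesgue) = 0"
  shows "AE x in lebesgue. f x = 0"
proof -
  obtain h where [measurable]: "h \<in> borel_measurable borel" and h: "AE x in lborel. f x = h x"
    using completion_ex_borel_measurable_real[OF f] by auto
  have hl[measurable]: "h \<in> borel_measurable lebesgue" by (simp add: measurable_completion)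
  have h': "AE x in lebesgue. f x = h x" using h by (rule AE_completion)
  have "AE x in lborel. h x = 0"
  proof (rule fundamental_lemma_lborel)
    have "integrable lebesgue (\<lambda>x. (h x)\<^sup>2)"
      using f2 by (rule integrable_cong_AE_imp) (use h' in auto)
    then show "integrable lborel (\<lambda>x. (h x)\<^sup>2)" by (simp add: integrable_completion)
    fix \<phi> :: "'a \<Rightarrow> real" assume t: "test_fun \<phi>"
    then have [measurable]: "\<phi> \<in> borel_measurable borel"
      using test_fun_gradientE[OF t] borel_measurable_continuous_onI by blast
    then have pl[measurable]: "\<phi> \<in> borel_measurable lebesgue" by (simp add: measurable_completion)
    have "(\<integral>x. h x * \<phi> x \<partial>lebesgue) = (\<integral>x. f x * \<phi> x \<partial>lebesgue)"
      by (rule integral_cong_AE) (use h' f in auto)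
    with 0[OF t] show "(\<integral>x. h x * \<phi> x \<partial>lborel) = 0" by (simp add: integral_completion)
  qed auto
  with h have "AE x in lborel. f x = 0" by auto
  then show ?thesis by (rule AE_completion)
qed

lemma L2_grad_component:
  fixes g :: "'a::euclidean_space \<Rightarrow> 'a"
  assumes "L2_grad u g" "b \<in> Basis"
  shows "(\<lambda>x. g x \<bullet> b) \<in> borel_measurable lebesgue" "integrable lebesgue (\<lambda>x. (g x \<bullet> b)\<^sup>2)"
proof -
  from assms have [measurable]: "g \<in> borel_measurable lebesgue" by (simp add: L2_grad_def)
  show "(\<lambda>x. g x \<bullet> b) \<in> borel_measurable lebesgue" by measurable
  show "integrable lebesgue (\<lambda>x. (g x \<bullet> b)\<^sup>2)"
    by (rule integrable_L2_dominated[of _ _ "\<lambda>x. norm (g x)"])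
       (use assms in \<open>auto simp: L2_grad_def intro: Basis_le_norm\<close>)
qed

text \<open>This makes the choice in \<open>wgrad\<close> harmless: any explicitly computed weak
  gradient agrees with the chosen one almost everywhere.\<close>

lemma L2_grad_unique:
  fixes u :: "'a::euclidean_space \<Rightarrow> real"
  assumes g: "L2_grad u g" and h: "L2_grad u h"
  shows "AE x in lebesgue. g x = h x"
proof -
  have "AE x in lebesgue. (g x - h x) \<bullet> b = 0" if b: "b \<in> Basis" for b
  proof (rule fundamental_lemma)
    note [measurable] = L2_grad_component(1)[OF g b] L2_grad_component(1)[OF h b]
    note i = L2_grad_component(2)[OF g b] L2_grad_component(2)[OF h b]
    show "(\<lambda>x. (g x - h x) \<bullet> b) \<in> borel_measurable lebesgue" by (simp add: inner_diff_left)
    show "integrable lebesgue (\<lambda>x. ((g x - h x) \<bullet> b)\<^sup>2)"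
      using integrable_L2_diff[OF _ _ i] by (simp add: inner_diff_left)
    fix \<phi> :: "'a \<Rightarrow> real" assume t: "test_fun \<phi>"
    from t obtain d\<phi> R M where d: "\<And>x. (\<phi> has_derivative (\<lambda>h. d\<phi> x \<bullet> h)) (at x)"
      "continuous_on UNIV \<phi>" "\<And>x. norm x \<ge> R \<Longrightarrow> \<phi> x = 0" "\<And>x. \<bar>\<phi> x\<bar> \<le> M"
      by (rule test_fun_gradientE) blast
    have "\<phi> \<in> borel_measurable borel" using d borel_measurable_continuous_onI by blast
    then have [measurable]: "\<phi> \<in> borel_measurable lebesgue"
       and pi: "integrable lebesgue (\<lambda>x. (\<phi> x)\<^sup>2)"
      using integrable_bounded_support[of \<phi> R M] d by (auto simp: measurable_completion integrable_completion)
    have "(\<integral>x. g x \<bullet> b * \<phi> x \<partial>lebesgue) = (\<integral>x. h x \<bullet> b * \<phi> x \<partial>lebesgue)"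
      using g h b t d(1) unfolding L2_grad_def weak_gradient_def
      by (metis (mono_tags, lifting) neg_equal_iff_equal)
    moreover have "integrable lebesgue (\<lambda>x. (g x \<bullet> b) * \<phi> x)" "integrable lebesgue (\<lambda>x. (h x \<bullet> b) * \<phi> x)"
      by (intro integrable_mult_L2 i pi; simp)+
    ultimately show "(\<integral>x. (g x - h x) \<bullet> b * \<phi> x \<partial>lebesgue) = 0"
      by (simp add: inner_diff_left left_diff_distrib)
  qed
  then have "AE x in lebesgue. \<forall>b\<in>Basis. (g x - h x) \<bullet> b = 0"
    by (subst AE_finite_all) auto
  then show ?thesis
    by eventually_elim (metis euclidean_all_zero_iff right_minus_eq)
qed

lemma L2_grad_wgrad: "u \<in> H1 \<Longrightarrow> L2_grad u (wgrad u)"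
  using someI_ex[of "L2_grad u"] by (auto simp: H1_def wgrad_def)

section \<open>Translation and chain rule for weak partial derivatives\<close>

text \<open>Averages over the unit interval are integrals against a finite measure of total mass
  one, so that Fubini, Jensen and dominated convergence apply to them without carrying
  indicators.\<close>

definition unif01 :: "real measure" where
  "unif01 = density lborel (\<lambda>\<sigma>. ennreal (indicator {0..1} \<sigma>))"

lemma sets_unif01[measurable_cong]: "sets unif01 = sets borel" by (simp add: unif01_def)

lemma space_unif01[simp]: "space unif01 = UNIV" by (simp add: unif01_def)

lemma emeasure_unif01: "emeasure unif01 UNIV = 1"
  by (simp add: unif01_def emeasure_density ennreal_indicator)

lemma finite_measure_unif01: "finite_measure unif01"
  by (rule finite_measureI) (simp add: emeasure_unif01)

lemma measure_unif01: "measure unif01 UNIV = 1"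
  by (simp add: measure_def emeasure_unif01)

lemma AE_unif01: "AE \<sigma> in unif01. 0 \<le> \<sigma> \<and> \<sigma> \<le> 1"
  unfolding unif01_def by (subst AE_density) (auto simp: indicator_def)

lemma integral_unif01:
  "f \<in> borel_measurable borel \<Longrightarrow> (\<integral>\<sigma>. f \<sigma> \<partial>unif01) = (\<integral>\<sigma>. f \<sigma> * indicator {0..1} \<sigma> \<partial>lborel)"
  for f :: "real \<Rightarrow> real"
  unfolding unif01_def by (subst integral_density) (auto simp: mult.commute)

interpretation unif01: finite_measure unif01 by (rule finite_measure_unif01)

interpretation lborel_unif01: pair_sigma_finite "lborel :: 'a::euclidean_space measure" unif01 ..

text \<open>Nonnegativity of the variance, expanded with total mass one.\<close>

lemma unif01_Jensen:
  fixes f :: "real \<Rightarrow> real"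
  assumes f[measurable]: "f \<in> borel_measurable borel" and f2: "integrable unif01 (\<lambda>\<sigma>. (f \<sigma>)\<^sup>2)"
  shows "(\<integral>\<sigma>. f \<sigma> \<partial>unif01)\<^sup>2 \<le> (\<integral>\<sigma>. (f \<sigma>)\<^sup>2 \<partial>unif01)"
proof -
  have f1: "integrable unif01 f"
    using integrable_mult_L2[of f unif01 "\<lambda>_. 1"] f2 by simp
  define m where "m = (\<integral>\<sigma>. f \<sigma> \<partial>unif01)"
  have "0 \<le> (\<integral>\<sigma>. (f \<sigma> - m)\<^sup>2 \<partial>unif01)" by simp
  also have "\<dots> = (\<integral>\<sigma>. (f \<sigma>)\<^sup>2 + m\<^sup>2 - 2 * m * f \<sigma> \<partial>unif01)"
    by (simp add: power2_diff mult_ac)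
  also have "\<dots> = (\<integral>\<sigma>. (f \<sigma>)\<^sup>2 \<partial>unif01) + m\<^sup>2 - 2 * m * m"
    using f1 f2 by (simp add: measure_unif01 m_def)
  finally show ?thesis by (simp add: m_def power2_eq_square)
qed

context
  fixes b :: "'a::euclidean_space"
begin

text \<open>For fixed \<sigma> the shift preserves the integral over x, and averaging over \<sigma>
  with total mass one changes nothing.\<close>

lemma integrable_L2_shift:
  fixes h :: "'a \<Rightarrow> real"
  assumes [measurable]: "h \<in> borel_measurable borel" and h2: "integrable lborel (\<lambda>x. (h x)\<^sup>2)"
  shows "integrable (lborel \<Otimes>\<^sub>M unif01) (\<lambda>(x, \<sigma>). (h (x + (\<sigma> * s) *\<^sub>R b))\<^sup>2)"
    and "(\<integral>x. (\<integral>\<sigma>. (h (x + (\<sigma> * s) *\<^sub>R b))\<^sup>2 \<partial>unif01) \<partial>lborel) = (\<integral>x. (h x)\<^sup>2 \<partial>lborel)"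
proof -
  let ?f = "\<lambda>(x, \<sigma>). (h (x + (\<sigma> * s) *\<^sub>R b))\<^sup>2"
  have "(\<integral>\<^sup>+z. ennreal (?f z) \<partial>(lborel \<Otimes>\<^sub>M unif01)) =
        (\<integral>\<^sup>+\<sigma>. (\<integral>\<^sup>+x. ennreal ((h (x + (\<sigma> * s) *\<^sub>R b))\<^sup>2) \<partial>lborel) \<partial>unif01)"
    by (subst lborel_unif01.nn_integral_snd[symmetric]) (auto simp: split_def)
  also have "\<dots> = (\<integral>\<^sup>+x. ennreal ((h x)\<^sup>2) \<partial>lborel)"
    by (subst nn_integral_lborel_translate) (auto simp: emeasure_unif01)
  also have "\<dots> < \<infinity>" using h2 by (simp add: nn_integral_eq_integral less_top[symmetric])
  finally show i: "integrable (lborel \<Otimes>\<^sub>M unif01) ?f"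
    by (intro integrableI_nonneg) (auto simp: split_def)
  have "(\<integral>x. (\<integral>\<sigma>. (h (x + (\<sigma> * s) *\<^sub>R b))\<^sup>2 \<partial>unif01) \<partial>lborel) =
        (\<integral>\<sigma>. (\<integral>x. (h (x + (\<sigma> * s) *\<^sub>R b))\<^sup>2 \<partial>lborel) \<partial>unif01)"
    using lborel_unif01.Fubini_integral[OF i] by simp
  also have "\<dots> = (\<integral>x. (h x)\<^sup>2 \<partial>lborel)"
    by (subst integral_lborel_translate[of "\<lambda>x. (h x)\<^sup>2"]) (auto simp: measure_unif01)
  finally show "(\<integral>x. (\<integral>\<sigma>. (h (x + (\<sigma> * s) *\<^sub>R b))\<^sup>2 \<partial>unif01) \<partial>lborel) = (\<integral>x. (h x)\<^sup>2 \<partial>lborel)" .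
qed

lemma Fubini_shift:
  fixes h k :: "'a \<Rightarrow> real"
  assumes [measurable]: "h \<in> borel_measurable borel" "k \<in> borel_measurable borel"
    and h2: "integrable lborel (\<lambda>x. (h x)\<^sup>2)" and k2: "integrable lborel (\<lambda>x. (k x)\<^sup>2)"
  shows "(\<integral>x. h x * (\<integral>\<sigma>. k (x + (\<sigma> * s) *\<^sub>R b) \<partial>unif01) \<partial>lborel) =
         (\<integral>\<sigma>. (\<integral>x. h x * k (x + (\<sigma> * s) *\<^sub>R b) \<partial>lborel) \<partial>unif01)"
proof -
  \<comment> \<open>Shift parameter 0 turns the unshifted factor h into an instance of the same
    integrability lemma.\<close>
  have "integrable (lborel \<Otimes>\<^sub>M unif01) (\<lambda>z. h (fst z) * k (fst z + (snd z * s) *\<^sub>R b))"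
    by (rule integrable_mult_L2)
       (use integrable_L2_shift(1)[OF _ h2, of 0] integrable_L2_shift(1)[OF _ k2, of s] in \<open>auto simp: split_def\<close>)
  then show ?thesis
    by (subst lborel_unif01.Fubini_integral) (auto simp: split_def)
qed

end

text \<open>Dominated convergence: the Lipschitz constant of the test function bounds all quotients,
  and its compact support localises them. The steps are powers of 1/2 to match the almost everywhere
  convergence of shifts used in \<open>chain_rule\<close>.\<close>

lemma difference_quotient_tendsto:
  fixes f \<phi> :: "'a::euclidean_space \<Rightarrow> real"
  assumes [measurable]: "f \<in> borel_measurable borel" and f2: "integrable lborel (\<lambda>x. (f x)\<^sup>2)"
    and t: "test_fun \<phi>" and d: "\<And>x. (\<phi> has_derivative (\<lambda>h. d\<phi> x \<bullet> h)) (at x)"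
    and nb: "norm b = 1"
  shows "(\<lambda>m. \<integral>x. f x * ((\<phi> x - \<phi> (x - (1/2) ^ m *\<^sub>R b)) / (1/2) ^ m) \<partial>lborel)
           \<longlonglongrightarrow> (\<integral>x. f x * (d\<phi> x \<bullet> b) \<partial>lborel)"
proof -
  from t d obtain R M where c: "continuous_on UNIV d\<phi>" "continuous_on UNIV \<phi>" and M0: "M > 0"
    and supp: "\<And>x. norm x \<ge> R \<Longrightarrow> \<phi> x = 0"
    and Lip: "\<And>x y. \<bar>\<phi> x - \<phi> y\<bar> \<le> M * norm (x - y)"
    by (rule test_fun_given_gradientE) blast
  note [measurable] = borel_measurable_continuous_onI[OF c(2)]
  define \<tau> :: "nat \<Rightarrow> real" where "\<tau> m = (1/2) ^ m" for m
  have \<tau>: "\<tau> m > 0" "\<tau> m \<le> 1" for m by (auto simp: \<tau>_def power_le_one)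
  have \<tau>0: "\<tau> \<longlonglongrightarrow> 0" unfolding \<tau>_def by (rule LIMSEQ_power_zero) simp
  \<comment> \<open>Shifts have length at most one, so enlarging the support radius by one covers
    every shifted test function.\<close>
  define B where "B = (indicator (ball 0 (R + 1)) :: 'a \<Rightarrow> real)"
  have [measurable]: "B \<in> borel_measurable borel" unfolding B_def by (rule borel_measurable_indicator) simp
  have B2: "integrable lborel (\<lambda>x. (M * B x)\<^sup>2)"
    by (rule integrable_bounded_support[of _ "R + 1" M]) (use M0 in \<open>auto simp: B_def indicator_def\<close>)
  have out: "\<phi> (x - c *\<^sub>R b) = 0" if "\<bar>c\<bar> \<le> 1" "x \<notin> ball 0 (R + 1)" for x c
  proof (rule supp)
    have "norm x \<le> norm (x - c *\<^sub>R b) + norm (c *\<^sub>R b)" by (metis diff_add_cancel norm_triangle_ineq)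
    with that show "R \<le> norm (x - c *\<^sub>R b)" by (simp add: nb)
  qed
  have "(\<lambda>m. \<integral>x. f x * ((\<phi> x - \<phi> (x - \<tau> m *\<^sub>R b)) / \<tau> m) \<partial>lborel) \<longlonglongrightarrow> (\<integral>x. f x * (d\<phi> x \<bullet> b) \<partial>lborel)"
  proof (rule integral_dominated_convergence[where w = "\<lambda>x. \<bar>f x * (M * B x)\<bar>"])
    show "(\<lambda>x. f x * (d\<phi> x \<bullet> b)) \<in> borel_measurable lborel"
      using borel_measurable_continuous_onI[OF c(1)] by measurable
    show "integrable lborel (\<lambda>x. \<bar>f x * (M * B x)\<bar>)"
      by (intro integrable_abs integrable_mult_L2 f2 B2) auto
    show "AE x in lborel. (\<lambda>m. f x * ((\<phi> x - \<phi> (x - \<tau> m *\<^sub>R b)) / \<tau> m)) \<longlonglongrightarrow> f x * (d\<phi> x \<bullet> b)"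
    proof (intro AE_I2 tendsto_mult tendsto_const)
      fix x
      have "((\<lambda>h. x - h *\<^sub>R b) has_derivative (\<lambda>h. - (h *\<^sub>R b))) (at 0)"
        by (auto intro!: derivative_eq_intros)
      from has_derivative_compose[OF this d]
      have "((\<lambda>h. \<phi> (x - h *\<^sub>R b)) has_real_derivative - (d\<phi> x \<bullet> b)) (at 0)"
        unfolding has_field_derivative_def by (rule has_derivative_eq_rhs) (simp add: fun_eq_iff)
      then have "((\<lambda>h. - ((\<phi> (x - h *\<^sub>R b) - \<phi> x) / h)) \<longlongrightarrow> - (- (d\<phi> x \<bullet> b))) (at 0)"
        unfolding DERIV_def by (intro tendsto_minus) simp
      moreover have "filterlim \<tau> (at 0) sequentially"
        using \<tau>0 \<tau>(1) by (auto simp: filterlim_at intro!: always_eventually) (metis less_irrefl)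
      ultimately have "(\<lambda>m. - ((\<phi> (x - \<tau> m *\<^sub>R b) - \<phi> x) / \<tau> m)) \<longlonglongrightarrow> - (- (d\<phi> x \<bullet> b))"
        by (rule filterlim_compose)
      then show "(\<lambda>m. (\<phi> x - \<phi> (x - \<tau> m *\<^sub>R b)) / \<tau> m) \<longlonglongrightarrow> d\<phi> x \<bullet> b"
        by (simp add: minus_divide_left)
    qed
    fix m
    show "AE x in lborel. norm (f x * ((\<phi> x - \<phi> (x - \<tau> m *\<^sub>R b)) / \<tau> m)) \<le> \<bar>f x * (M * B x)\<bar>"
    proof (rule AE_I2)
      fix x
      have "\<bar>(\<phi> x - \<phi> (x - \<tau> m *\<^sub>R b)) / \<tau> m\<bar> \<le> M * B x"
      proof (cases "x \<in> ball 0 (R + 1)")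
        case True
        have "\<bar>\<phi> x - \<phi> (x - \<tau> m *\<^sub>R b)\<bar> \<le> M * \<tau> m"
          using Lip[of x "x - \<tau> m *\<^sub>R b"] nb \<tau>(1)[of m] by simp
        then show ?thesis using True \<tau>(1)[of m] by (simp add: B_def abs_divide pos_divide_le_eq)
      next
        case False
        then show ?thesis using out[of 0 x] out[of "\<tau> m" x] \<tau>[of m] by (simp add: B_def)
      qed
      then show "norm (f x * ((\<phi> x - \<phi> (x - \<tau> m *\<^sub>R b)) / \<tau> m)) \<le> \<bar>f x * (M * B x)\<bar>"
        unfolding real_norm_def abs_mult[of "f x"] by (intro mult_left_mono) auto
    qed
  qed measurable
  then show ?thesis unfolding \<tau>_def .
qed

section \<open>Difference identity and chain rule in one coordinate direction\<close>

text \<open>Here v is the weak partial derivative of u in direction b. Both are Borel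
  representatives on \<open>lborel\<close>, so that composites with shifts are jointly measurable in
  the point and the shift parameter.\<close>

locale weak_partial =
  fixes u v :: "'a::euclidean_space \<Rightarrow> real" and b :: 'a
  assumes u_meas[measurable]: "u \<in> borel_measurable borel" and u2: "integrable lborel (\<lambda>x. (u x)\<^sup>2)"
    and v_meas[measurable]: "v \<in> borel_measurable borel" and v2: "integrable lborel (\<lambda>x. (v x)\<^sup>2)"
    and b: "b \<in> Basis"
    and parts: "\<And>\<phi> d\<phi>. test_fun \<phi> \<Longrightarrow> (\<And>x. (\<phi> has_derivative (\<lambda>h. d\<phi> x \<bullet> h)) (at x)) \<Longrightarrow>
        (\<integral>x. u x * (d\<phi> x \<bullet> b) \<partial>lborel) = - (\<integral>x. v x * \<phi> x \<partial>lborel)"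
begin

abbreviation avg :: "real \<Rightarrow> 'a \<Rightarrow> real" where
  "avg t x \<equiv> (\<integral>\<sigma>. v (x + (\<sigma> * t) *\<^sub>R b) \<partial>unif01)"

lemma avg_measurable[measurable]: "avg t \<in> borel_measurable borel"
proof -
  have "(\<lambda>x. avg t x) \<in> borel_measurable lborel"
    by (rule unif01.borel_measurable_lebesgue_integral) (auto simp: split_def)
  then show ?thesis by simp
qed

lemma avg_square_le: "AE x in lborel. (avg t x)\<^sup>2 \<le> (\<integral>\<sigma>. (v (x + (\<sigma> * t) *\<^sub>R b))\<^sup>2 \<partial>unif01)"
proof -
  have "AE x in lborel. integrable unif01 (\<lambda>\<sigma>. (v (x + (\<sigma> * t) *\<^sub>R b))\<^sup>2)"
    using lborel_unif01.AE_integrable_fst'[OF integrable_L2_shift(1)[OF v_meas v2]] by simp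
  then show ?thesis
    by eventually_elim (rule unif01_Jensen, auto)
qed

lemma avg_L2: "integrable lborel (\<lambda>x. (avg t x)\<^sup>2)"
proof (rule Bochner_Integration.integrable_bound)
  show "integrable lborel (\<lambda>x. \<integral>\<sigma>. (v (x + (\<sigma> * t) *\<^sub>R b))\<^sup>2 \<partial>unif01)"
    using lborel_unif01.integrable_fst'[OF integrable_L2_shift(1)[OF v_meas v2]] by simp
qed (use avg_square_le[of t] in auto)

lemma u_shift_L2: "integrable lborel (\<lambda>x. (u (x + c))\<^sup>2)"
  using integrable_lborel_translate[of "\<lambda>x. (u x)\<^sup>2" c] u2 by simp

text \<open>Tested against a test function, the shift moves onto the test function, where the
  classical fundamental theorem of calculus holds along b. Integration by parts against each
  translate, Fubini and a shift back produce the average of v; the fundamental lemma removes the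
  test function.\<close>

lemma difference_eq_avg: "AE x in lborel. u (x + t *\<^sub>R b) - u x = t * avg t x"
proof -
  have "AE x in lborel. (u (x + t *\<^sub>R b) - u x) - t * avg t x = 0"
  proof (rule fundamental_lemma_lborel)
    show "integrable lborel (\<lambda>x. ((u (x + t *\<^sub>R b) - u x) - t * avg t x)\<^sup>2)"
      using avg_L2[of t] u_shift_L2 u2
      by (intro integrable_L2_diff) (auto simp: power_mult_distrib)
    fix \<phi> :: "'a \<Rightarrow> real" assume t: "test_fun \<phi>"
    from t obtain d\<phi> R M where d: "\<And>x. (\<phi> has_derivative (\<lambda>h. d\<phi> x \<bullet> h)) (at x)"
      and c: "continuous_on UNIV d\<phi>" "continuous_on UNIV \<phi>"
      and supp: "\<And>x. norm x \<ge> R \<Longrightarrow> \<phi> x = 0" "\<And>x. norm x \<ge> R \<Longrightarrow> d\<phi> x = 0"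
      and M: "\<And>x. \<bar>\<phi> x\<bar> \<le> M" "\<And>x. norm (d\<phi> x) \<le> M"
      by (rule test_fun_gradientE) blast
    note [measurable] = borel_measurable_continuous_onI[OF c(1)] borel_measurable_continuous_onI[OF c(2)]
    have p2: "integrable lborel (\<lambda>x. (\<phi> x)\<^sup>2)" by (rule integrable_bounded_support[of _ R M]) (auto simp: supp M)
    then have ps2: "integrable lborel (\<lambda>x. (\<phi> (x - c))\<^sup>2)" for c
      using integrable_lborel_translate[of "\<lambda>x. (\<phi> x)\<^sup>2" "-c"] by simp
    have dp2: "integrable lborel (\<lambda>x. (d\<phi> x \<bullet> b)\<^sup>2)"
      by (rule integrable_bounded_support[of _ R M])
         (use b Basis_le_norm order_trans M(2) in \<open>auto simp: supp\<close>, blast)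
    have cc: "continuous_on UNIV (\<lambda>\<sigma>. (-t) * (d\<phi> (x + (\<sigma> * (-t)) *\<^sub>R b) \<bullet> b))" for x
      by (intro continuous_on_mult continuous_on_inner continuous_on_compose2[OF c(1)] continuous_on_const
            continuous_on_add continuous_on_scaleR continuous_on_id) auto
    have FTC: "\<phi> (x - t *\<^sub>R b) - \<phi> x = (-t) * (\<integral>\<sigma>. d\<phi> (x + (\<sigma> * (-t)) *\<^sub>R b) \<bullet> b \<partial>unif01)" for x
    proof -
      have "(\<integral>\<sigma>. (-t) * (d\<phi> (x + (\<sigma> * (-t)) *\<^sub>R b) \<bullet> b) * indicator {0..1} \<sigma> \<partial>lborel) =
            \<phi> (x + (1 * (-t)) *\<^sub>R b) - \<phi> (x + (0 * (-t)) *\<^sub>R b)"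
      proof (rule integral_FTC_Icc_real)
        fix \<sigma> :: real
        have "((\<lambda>\<sigma>. x + (\<sigma> * (-t)) *\<^sub>R b) has_derivative (\<lambda>h. (h * (-t)) *\<^sub>R b)) (at \<sigma>)"
          by (auto intro!: derivative_eq_intros)
        from has_derivative_compose[OF this d]
        show "((\<lambda>\<sigma>. \<phi> (x + (\<sigma> * (-t)) *\<^sub>R b)) has_real_derivative (-t) * (d\<phi> (x + (\<sigma> * (-t)) *\<^sub>R b) \<bullet> b)) (at \<sigma>)"
          unfolding has_field_derivative_def by (rule has_derivative_eq_rhs) (simp add: fun_eq_iff)
        show "isCont (\<lambda>\<sigma>. (-t) * (d\<phi> (x + (\<sigma> * (-t)) *\<^sub>R b) \<bullet> b)) \<sigma>"
          using cc by (simp add: continuous_on_eq_continuous_at)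
      qed auto
      then show ?thesis
        by (subst integral_unif01) (auto simp: mult.assoc)
    qed
    have inner: "(\<integral>x. u x * (d\<phi> (x + (\<sigma> * (-t)) *\<^sub>R b) \<bullet> b) \<partial>lborel) = - (\<integral>x. v (x + (\<sigma> * t) *\<^sub>R b) * \<phi> x \<partial>lborel)" for \<sigma>
    proof -
      have "(\<integral>x. u x * (d\<phi> (x - (\<sigma> * t) *\<^sub>R b) \<bullet> b) \<partial>lborel) = - (\<integral>x. v x * \<phi> (x - (\<sigma> * t) *\<^sub>R b) \<partial>lborel)"
      proof (rule parts[OF test_fun_translate[OF t]])
        fix x show "((\<lambda>x. \<phi> (x - (\<sigma> * t) *\<^sub>R b)) has_derivative (\<lambda>h. d\<phi> (x - (\<sigma> * t) *\<^sub>R b) \<bullet> h)) (at x)"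
          by (rule has_derivative_compose[of "\<lambda>x. x - (\<sigma> * t) *\<^sub>R b" "\<lambda>h. h" x UNIV \<phi>, simplified])
             (auto intro!: derivative_eq_intros d)
      qed
      also have "(\<integral>x. v x * \<phi> (x - (\<sigma> * t) *\<^sub>R b) \<partial>lborel) = (\<integral>x. v (x + (\<sigma> * t) *\<^sub>R b) * \<phi> x \<partial>lborel)"
        using integral_lborel_translate[of "\<lambda>x. v x * \<phi> (x - (\<sigma> * t) *\<^sub>R b)" "(\<sigma> * t) *\<^sub>R b"] by simp
      finally show ?thesis by simp
    qed
    have "(\<integral>x. (u (x + t *\<^sub>R b) - u x) * \<phi> x \<partial>lborel) = (\<integral>x. u (x + t *\<^sub>R b) * \<phi> x \<partial>lborel) - (\<integral>x. u x * \<phi> x \<partial>lborel)"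
      by (subst Bochner_Integration.integral_diff[symmetric])
         (auto intro!: integrable_mult_L2 p2 u2 u_shift_L2 simp: left_diff_distrib)
    also have "(\<integral>x. u (x + t *\<^sub>R b) * \<phi> x \<partial>lborel) = (\<integral>x. u x * \<phi> (x - t *\<^sub>R b) \<partial>lborel)"
      using integral_lborel_translate[of "\<lambda>x. u x * \<phi> (x - t *\<^sub>R b)" "t *\<^sub>R b"] by simp
    also have "\<dots> - (\<integral>x. u x * \<phi> x \<partial>lborel) = (\<integral>x. u x * (\<phi> (x - t *\<^sub>R b) - \<phi> x) \<partial>lborel)"
      by (subst Bochner_Integration.integral_diff[symmetric])
         (auto intro!: integrable_mult_L2 p2 u2 ps2 simp: right_diff_distrib)
    also have "\<dots> = (-t) * (\<integral>x. u x * (\<integral>\<sigma>. d\<phi> (x + (\<sigma> * (-t)) *\<^sub>R b) \<bullet> b \<partial>unif01) \<partial>lborel)"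
      unfolding FTC by (subst integral_mult_right_zero[symmetric]) (simp add: mult_ac)
    also have "\<dots> = (-t) * (\<integral>\<sigma>. (\<integral>x. u x * (d\<phi> (x + (\<sigma> * (-t)) *\<^sub>R b) \<bullet> b) \<partial>lborel) \<partial>unif01)"
      by (subst Fubini_shift[where k = "\<lambda>x. d\<phi> x \<bullet> b"]) (auto intro: u2 dp2)
    also have "\<dots> = t * (\<integral>\<sigma>. (\<integral>x. \<phi> x * v (x + (\<sigma> * t) *\<^sub>R b) \<partial>lborel) \<partial>unif01)"
      unfolding inner by (simp add: mult.commute)
    also have "\<dots> = t * (\<integral>x. \<phi> x * avg t x \<partial>lborel)"
      by (subst Fubini_shift[where h = \<phi>]) (auto intro: p2 v2)
    also have "\<dots> = (\<integral>x. t * avg t x * \<phi> x \<partial>lborel)"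
      by (subst integral_mult_right_zero[symmetric]) (simp add: mult_ac)
    finally show "(\<integral>x. (u (x + t *\<^sub>R b) - u x - t * avg t x) * \<phi> x \<partial>lborel) = 0"
      by (subst left_diff_distrib, subst Bochner_Integration.integral_diff)
         (auto intro!: integrable_mult_L2 integrable_L2_diff u2 p2 u_shift_L2 avg_L2 simp: power_mult_distrib)
  qed auto
  then show ?thesis by simp
qed

lemma difference_L2_le: "(\<integral>x. (u (x + t *\<^sub>R b) - u x)\<^sup>2 \<partial>lborel) \<le> t\<^sup>2 * (\<integral>x. (v x)\<^sup>2 \<partial>lborel)"
proof -
  have "(\<integral>x. (u (x + t *\<^sub>R b) - u x)\<^sup>2 \<partial>lborel) = (\<integral>x. t\<^sup>2 * (avg t x)\<^sup>2 \<partial>lborel)"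
    by (rule integral_cong_AE) (use difference_eq_avg[of t] in \<open>auto simp: power_mult_distrib\<close>)
  also have "\<dots> = t\<^sup>2 * (\<integral>x. (avg t x)\<^sup>2 \<partial>lborel)" by simp
  also have "(\<integral>x. (avg t x)\<^sup>2 \<partial>lborel) \<le> (\<integral>x. (\<integral>\<sigma>. (v (x + (\<sigma> * t) *\<^sub>R b))\<^sup>2 \<partial>unif01) \<partial>lborel)"
    using lborel_unif01.integrable_fst'[OF integrable_L2_shift(1)[OF v_meas v2]]
    by (intro integral_mono_AE avg_L2 avg_square_le) simp
  also have "\<dots> = (\<integral>x. (v x)\<^sup>2 \<partial>lborel)" by (rule integrable_L2_shift(2)[OF v_meas v2])
  finally show ?thesis by (simp add: mult_left_mono)
qed

text \<open>\<open>difference_L2_le\<close> bounds the squared L^2 distance of the m-th shift by a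
  multiple of (1/4)^m. Summability of these bounds upgrades L^2 convergence to convergence almost
  everywhere along the whole sequence.\<close>

lemma shift_tendsto_AE:
  fixes c :: "nat \<Rightarrow> real"
  assumes "\<And>m. \<bar>c m\<bar> \<le> (1/2) ^ m"
  shows "AE x in lborel. (\<lambda>m. u (x + c m *\<^sub>R b)) \<longlonglongrightarrow> u x"
proof -
  define V where "V = (\<integral>x. (v x)\<^sup>2 \<partial>lborel)"
  have V: "V \<ge> 0" by (simp add: V_def)
  have le: "(\<integral>\<^sup>+x. ennreal ((u (x + c m *\<^sub>R b) - u x)\<^sup>2) \<partial>lborel) \<le> ennreal (V * (1/4) ^ m)" for m
  proof -
    have "(c m)\<^sup>2 \<le> ((1/2) ^ m)\<^sup>2" using assms[of m] by (intro power2_le_iff_abs_le[THEN iffD2]) auto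
    also have "\<dots> = (1/4 :: real) ^ m" by (simp add: power2_eq_square power_mult_distrib[symmetric])
    finally have "(c m)\<^sup>2 * V \<le> V * (1/4) ^ m" using V by (simp add: mult.commute mult_left_mono)
    with difference_L2_le[of "c m"] have "(\<integral>x. (u (x + c m *\<^sub>R b) - u x)\<^sup>2 \<partial>lborel) \<le> V * (1/4) ^ m"
      by (simp add: V_def)
    moreover have "(\<integral>\<^sup>+x. ennreal ((u (x + c m *\<^sub>R b) - u x)\<^sup>2) \<partial>lborel) =
        ennreal (\<integral>x. (u (x + c m *\<^sub>R b) - u x)\<^sup>2 \<partial>lborel)"
      by (intro nn_integral_eq_integral integrable_L2_diff u2 u_shift_L2) auto
    ultimately show ?thesis by (simp add: ennreal_leI)
  qed
  have "(\<integral>\<^sup>+x. (\<Sum>m. ennreal ((u (x + c m *\<^sub>R b) - u x)\<^sup>2)) \<partial>lborel) =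
        (\<Sum>m. (\<integral>\<^sup>+x. ennreal ((u (x + c m *\<^sub>R b) - u x)\<^sup>2) \<partial>lborel))"
    by (rule nn_integral_suminf) auto
  also have "\<dots> \<le> (\<Sum>m. ennreal (V * (1/4) ^ m))" by (intro suminf_le le) auto
  also have "\<dots> = ennreal (\<Sum>m. V * (1/4) ^ m)"
    using V by (intro suminf_ennreal2 summable_mult summable_geometric) auto
  finally have "(\<integral>\<^sup>+x. (\<Sum>m. ennreal ((u (x + c m *\<^sub>R b) - u x)\<^sup>2)) \<partial>lborel) \<noteq> \<infinity>"
    by (auto simp: top_unique)
  then have "AE x in lborel. (\<Sum>m. ennreal ((u (x + c m *\<^sub>R b) - u x)\<^sup>2)) \<noteq> \<infinity>"
    by (intro nn_integral_PInf_AE) auto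
  then show ?thesis
  proof eventually_elim
    case (elim x)
    then have "summable (\<lambda>m. (u (x + c m *\<^sub>R b) - u x)\<^sup>2)"
      by (intro summable_suminf_not_top) auto
    then have "(\<lambda>m. (u (x + c m *\<^sub>R b) - u x)\<^sup>2) \<longlonglongrightarrow> 0" by (rule summable_LIMSEQ_zero)
    from tendsto_real_sqrt[OF this] have "(\<lambda>m. \<bar>u (x + c m *\<^sub>R b) - u x\<bar>) \<longlonglongrightarrow> 0" by simp
    then have "(\<lambda>m. u (x + c m *\<^sub>R b) - u x) \<longlonglongrightarrow> 0" by (rule tendsto_rabs_zero_cancel)
    then show ?case by (simp add: LIM_zero_iff)
  qed
qed

text \<open>\<theta> is the divided difference of F, and its diagonal is the derivative of F. By
  \<open>difference_eq_avg\<close> the increment of F(u) over a step t is \<theta> times t times an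
  average of v; dividing by t and letting t tend to 0 leaves the diagonal.\<close>

lemma chain_rule:
  fixes F :: "real \<Rightarrow> real" and \<theta> :: "real \<Rightarrow> real \<Rightarrow> real"
  assumes F0: "F 0 = 0" and F: "\<And>p q. F p - F q = \<theta> p q * (p - q)"
    and \<theta>: "continuous_on UNIV (\<lambda>z. \<theta> (fst z) (snd z))" "\<And>p q. \<bar>\<theta> p q\<bar> \<le> 1"
    and t: "test_fun \<phi>" and d: "\<And>x. (\<phi> has_derivative (\<lambda>h. d\<phi> x \<bullet> h)) (at x)"
  shows "(\<integral>x. F (u x) * (d\<phi> x \<bullet> b) \<partial>lborel) = - (\<integral>x. \<theta> (u x) (u x) * v x * \<phi> x \<partial>lborel)"
proof -
  from t obtain R M where c: "continuous_on UNIV \<phi>" and M0: "M > 0"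
    and supp: "\<And>x. norm x \<ge> R \<Longrightarrow> \<phi> x = 0" and M: "\<And>x. \<bar>\<phi> x\<bar> \<le> M"
    by (rule test_fun_gradientE) blast
  note [measurable] = borel_measurable_continuous_onI[OF c]
  have nb: "norm b = 1" using b by simp
  have \<theta>m[measurable]: "(\<lambda>x. \<theta> (f x) (g x)) \<in> borel_measurable N"
    if "f \<in> borel_measurable N" "g \<in> borel_measurable N" for f g and N :: "'c measure"
    using borel_measurable_continuous_Pair[OF that \<theta>(1)] .
  have Feq: "F p = \<theta> p 0 * p" for p using F[of p 0] F0 by simp
  have [measurable]: "(\<lambda>x. F (u x)) \<in> borel_measurable borel" unfolding Feq by measurable
  have Fle: "\<bar>F p\<bar> \<le> \<bar>p\<bar>" for p
    using mult_right_mono[OF \<theta>(2)[of p 0], of "\<bar>p\<bar>"] by (simp add: Feq abs_mult)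
  have Fu2: "integrable lborel (\<lambda>x. (F (u x))\<^sup>2)"
    by (rule integrable_L2_dominated[OF _ u2]) (auto simp: Fle)
  have p2: "integrable lborel (\<lambda>x. (\<phi> x)\<^sup>2)" by (rule integrable_bounded_support[of _ R M]) (auto simp: supp M)
  define \<tau> :: "nat \<Rightarrow> real" where "\<tau> m = (1/2) ^ m" for m
  have \<tau>: "\<tau> m > 0" "\<tau> m \<le> 1" for m by (auto simp: \<tau>_def power_le_one)
  have \<tau>0: "\<tau> \<longlonglongrightarrow> 0" unfolding \<tau>_def by (rule LIMSEQ_power_zero) simp
  \<comment> \<open>A translation by \<sigma> times the step has moved the shift off v and onto u
    and the test function. No limit of shifts of v, which is only square integrable, is then
    required.\<close>
  define J where "J m \<sigma> = (\<integral>x. \<theta> (u (x + ((1 - \<sigma>) * \<tau> m) *\<^sub>R b)) (u (x - (\<sigma> * \<tau> m) *\<^sub>R b))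
                       * \<phi> (x - (\<sigma> * \<tau> m) *\<^sub>R b) * v x \<partial>lborel)" for m \<sigma>
  define B where "B = (indicator (ball 0 (R + 1)) :: 'a \<Rightarrow> real)"
  have [measurable]: "B \<in> borel_measurable borel" unfolding B_def by (rule borel_measurable_indicator) simp
  have B2: "integrable lborel (\<lambda>x. (M * B x)\<^sup>2)"
    by (rule integrable_bounded_support[of _ "R + 1" M]) (use M0 in \<open>auto simp: B_def indicator_def\<close>)
  have out: "\<phi> (x - c *\<^sub>R b) = 0" if "\<bar>c\<bar> \<le> 1" "x \<notin> ball 0 (R + 1)" for x c
  proof (rule supp)
    have "norm x \<le> norm (x - c *\<^sub>R b) + norm (c *\<^sub>R b)" by (metis diff_add_cancel norm_triangle_ineq)
    with that show "R \<le> norm (x - c *\<^sub>R b)" by (simp add: nb)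
  qed
  have bnd: "\<bar>\<phi> (x - c *\<^sub>R b)\<bar> \<le> M * B x" if "\<bar>c\<bar> \<le> 1" for x c
    using out[OF that, of x] M[of "x - c *\<^sub>R b"] by (auto simp: B_def indicator_def)

  have quot: "(\<integral>x. F (u x) * ((\<phi> x - \<phi> (x - \<tau> m *\<^sub>R b)) / \<tau> m) \<partial>lborel) = - (\<integral>\<sigma>. J m \<sigma> \<partial>unif01)" for m
  proof -
    let ?t = "\<tau> m"
    \<comment> \<open>The weight for which (F(u(x + t b)) - F(u x)) times the test function equals t
      times \<open>k x * avg t x\<close>, for almost every x.\<close>
    define k where "k x = \<theta> (u (x + ?t *\<^sub>R b)) (u x) * \<phi> x" for x
    have [measurable]: "k \<in> borel_measurable borel" unfolding k_def by measurable
    have k2: "integrable lborel (\<lambda>x. (k x)\<^sup>2)"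
      by (rule integrable_L2_dominated[OF _ p2])
         (use \<theta>(2) in \<open>auto simp: k_def abs_mult intro!: mult_left_le_one_le\<close>)
    have ps2: "integrable lborel (\<lambda>x. (\<phi> (x - c))\<^sup>2)" for c
      using integrable_lborel_translate[of "\<lambda>x. (\<phi> x)\<^sup>2" "-c"] p2 by simp
    have Fs2: "integrable lborel (\<lambda>x. (F (u (x + c)))\<^sup>2)" for c
      using integrable_lborel_translate[of "\<lambda>x. (F (u x))\<^sup>2" c] Fu2 by simp
    have Fm: "(\<lambda>x. F (u (x + c))) \<in> borel_measurable borel" for c unfolding Feq by measurable
    have inner: "(\<integral>x. k x * v (x + (\<sigma> * ?t) *\<^sub>R b) \<partial>lborel) = J m \<sigma>" for \<sigma>
    proof -
      have eq: "x - (\<sigma> * ?t) *\<^sub>R b + ?t *\<^sub>R b = x + ((1 - \<sigma>) * ?t) *\<^sub>R b" for x by (simp add: algebra_simps)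
      have "J m \<sigma> = (\<integral>x. k (x + - ((\<sigma> * ?t) *\<^sub>R b)) * v (x + - ((\<sigma> * ?t) *\<^sub>R b) + (\<sigma> * ?t) *\<^sub>R b) \<partial>lborel)"
        unfolding J_def k_def by (rule Bochner_Integration.integral_cong) (simp_all add: eq)
      also have "\<dots> = (\<integral>x. k x * v (x + (\<sigma> * ?t) *\<^sub>R b) \<partial>lborel)"
        by (rule integral_lborel_translate) measurable
      finally show ?thesis by simp
    qed
    have "(\<integral>x. F (u x) * (\<phi> x - \<phi> (x - ?t *\<^sub>R b)) \<partial>lborel) =
        (\<integral>x. F (u x) * \<phi> x \<partial>lborel) - (\<integral>x. F (u x) * \<phi> (x - ?t *\<^sub>R b) \<partial>lborel)"
      by (subst Bochner_Integration.integral_diff[symmetric])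
         (auto intro!: integrable_mult_L2 p2 ps2 Fu2 simp: right_diff_distrib)
    also have "(\<integral>x. F (u x) * \<phi> (x - ?t *\<^sub>R b) \<partial>lborel) = (\<integral>x. F (u (x + ?t *\<^sub>R b)) * \<phi> x \<partial>lborel)"
      using integral_lborel_translate[of "\<lambda>x. F (u x) * \<phi> (x - ?t *\<^sub>R b)" "?t *\<^sub>R b"] by simp
    also have "(\<integral>x. F (u x) * \<phi> x \<partial>lborel) - \<dots> = - (\<integral>x. (F (u (x + ?t *\<^sub>R b)) - F (u x)) * \<phi> x \<partial>lborel)"
      using integrable_mult_L2[of "\<lambda>x. F (u (x + ?t *\<^sub>R b))" lborel \<phi>]
        integrable_mult_L2[of "\<lambda>x. F (u x)" lborel \<phi>]
      by (simp add: left_diff_distrib Fm Fs2 Fu2 p2)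
    also have "(\<integral>x. (F (u (x + ?t *\<^sub>R b)) - F (u x)) * \<phi> x \<partial>lborel) = (\<integral>x. ?t * (k x * avg ?t x) \<partial>lborel)"
      by (rule integral_cong_AE) (use difference_eq_avg[of ?t] in \<open>auto simp: F k_def\<close>)
    also have "\<dots> = ?t * (\<integral>\<sigma>. J m \<sigma> \<partial>unif01)"
      by (simp add: Fubini_shift[OF _ _ k2 v2] inner)
    finally have "(\<integral>x. F (u x) * (\<phi> x - \<phi> (x - ?t *\<^sub>R b)) \<partial>lborel) = - (?t * (\<integral>\<sigma>. J m \<sigma> \<partial>unif01))" .
    then show ?thesis using \<tau>(1)[of m] by (simp add: field_simps)
  qed

  have lim1: "(\<lambda>m. \<integral>x. F (u x) * ((\<phi> x - \<phi> (x - \<tau> m *\<^sub>R b)) / \<tau> m) \<partial>lborel) \<longlonglongrightarrow> (\<integral>x. F (u x) * (d\<phi> x \<bullet> b) \<partial>lborel)"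
    unfolding \<tau>_def by (rule difference_quotient_tendsto[OF _ Fu2 t d nb]) auto

  have lim2: "(\<lambda>m. \<integral>\<sigma>. J m \<sigma> \<partial>unif01) \<longlonglongrightarrow> (\<integral>\<sigma>. (\<integral>x. \<theta> (u x) (u x) * \<phi> x * v x \<partial>lborel) \<partial>unif01)"
  proof (rule integral_dominated_convergence[where w = "\<lambda>_. \<integral>x. \<bar>M * B x * v x\<bar> \<partial>lborel"])
    have wi: "integrable lborel (\<lambda>x. \<bar>M * B x * v x\<bar>)"
      by (intro integrable_abs integrable_mult_L2 v2 B2) auto
    show Jm: "J m \<in> borel_measurable unif01" for m
      unfolding J_def[abs_def]
      by (rule lborel.borel_measurable_lebesgue_integral) (auto simp: split_def)
    have wb: "\<bar>\<theta> (u (x + ((1 - \<sigma>) * \<tau> m) *\<^sub>R b)) (u (x - (\<sigma> * \<tau> m) *\<^sub>R b)) * \<phi> (x - (\<sigma> * \<tau> m) *\<^sub>R b) * v x\<bar>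
             \<le> \<bar>M * B x * v x\<bar>" if s: "0 \<le> \<sigma>" "\<sigma> \<le> 1" for x m \<sigma>
    proof -
      have "\<bar>\<sigma> * \<tau> m\<bar> \<le> 1" using s \<tau>[of m] by (simp add: abs_mult mult_le_one)
      then have "\<bar>\<theta> (u (x + ((1 - \<sigma>) * \<tau> m) *\<^sub>R b)) (u (x - (\<sigma> * \<tau> m) *\<^sub>R b))\<bar> * \<bar>\<phi> (x - (\<sigma> * \<tau> m) *\<^sub>R b)\<bar> \<le> 1 * (M * B x)"
        by (intro mult_mono \<theta>(2) bnd) auto
      then have "\<bar>\<theta> (u (x + ((1 - \<sigma>) * \<tau> m) *\<^sub>R b)) (u (x - (\<sigma> * \<tau> m) *\<^sub>R b)) * \<phi> (x - (\<sigma> * \<tau> m) *\<^sub>R b)\<bar> \<le> \<bar>M * B x\<bar>"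
        unfolding abs_mult[of "\<theta> _ _"] by linarith
      then show ?thesis unfolding abs_mult[of _ "v x"] by (rule mult_right_mono) simp
    qed
    show "AE \<sigma> in unif01. (\<lambda>m. J m \<sigma>) \<longlonglongrightarrow> (\<integral>x. \<theta> (u x) (u x) * \<phi> x * v x \<partial>lborel)"
      using AE_unif01
    proof eventually_elim
      case (elim \<sigma>)
      show ?case unfolding J_def
      proof (rule integral_dominated_convergence[OF _ _ wi])
        \<comment> \<open>Both displacements are at most (1/2)^m because \<sigma> lies in the unit
          interval, so both arguments of \<theta> converge to \<open>u x\<close> almost
          everywhere.\<close>
        have "\<bar>(1 - \<sigma>) * \<tau> m\<bar> \<le> (1/2) ^ m" "\<bar>- (\<sigma> * \<tau> m)\<bar> \<le> (1/2) ^ m" for m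
          using elim by (auto simp: \<tau>_def abs_mult mult_left_le_one_le)
        from shift_tendsto_AE[OF this(1)] shift_tendsto_AE[OF this(2)]
        show "AE x in lborel. (\<lambda>m. \<theta> (u (x + ((1 - \<sigma>) * \<tau> m) *\<^sub>R b)) (u (x - (\<sigma> * \<tau> m) *\<^sub>R b)) *
                 \<phi> (x - (\<sigma> * \<tau> m) *\<^sub>R b) * v x) \<longlonglongrightarrow> \<theta> (u x) (u x) * \<phi> x * v x"
        proof eventually_elim
          case (elim x)
          have "(\<lambda>m. (u (x + ((1 - \<sigma>) * \<tau> m) *\<^sub>R b), u (x - (\<sigma> * \<tau> m) *\<^sub>R b))) \<longlonglongrightarrow> (u x, u x)"
            using elim by (intro tendsto_Pair) auto
          from continuous_on_tendsto_compose[OF \<theta>(1) this]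
          have 1: "(\<lambda>m. \<theta> (u (x + ((1 - \<sigma>) * \<tau> m) *\<^sub>R b)) (u (x - (\<sigma> * \<tau> m) *\<^sub>R b))) \<longlonglongrightarrow> \<theta> (u x) (u x)" by simp
          have "(\<lambda>m. x - (\<sigma> * \<tau> m) *\<^sub>R b) \<longlonglongrightarrow> x - (\<sigma> * 0) *\<^sub>R b"
            by (intro tendsto_intros \<tau>0)
          then have "(\<lambda>m. x - (\<sigma> * \<tau> m) *\<^sub>R b) \<longlonglongrightarrow> x" by simp
          from continuous_on_tendsto_compose[OF c this]
          have 2: "(\<lambda>m. \<phi> (x - (\<sigma> * \<tau> m) *\<^sub>R b)) \<longlonglongrightarrow> \<phi> x" by simp
          show ?case by (intro tendsto_mult tendsto_const 1 2)
        qed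
      qed (use wb elim in auto)
    qed
    show "AE \<sigma> in unif01. norm (J m \<sigma>) \<le> (\<integral>x. \<bar>M * B x * v x\<bar> \<partial>lborel)" for m
      using AE_unif01
    proof eventually_elim
      case (elim \<sigma>)
      show ?case unfolding J_def
        by (rule Bochner_Integration.integral_norm_bound_integral)
           (use wi wb elim in \<open>auto intro!: Bochner_Integration.integrable_bound[OF wi]\<close>)
    qed
  qed auto
  have "(\<lambda>m. - (\<integral>\<sigma>. J m \<sigma> \<partial>unif01)) \<longlonglongrightarrow> - (\<integral>x. \<theta> (u x) (u x) * \<phi> x * v x \<partial>lborel)"
    using tendsto_minus[OF lim2] by (simp add: measure_unif01)
  then have "(\<integral>x. F (u x) * (d\<phi> x \<bullet> b) \<partial>lborel) = - (\<integral>x. \<theta> (u x) (u x) * \<phi> x * v x \<partial>lborel)"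
    using lim1 unfolding quot by (rule LIMSEQ_unique[rotated])
  then show ?thesis by (simp add: mult_ac)
qed

end

context weak_partial
begin

text \<open>The function min is approximated by
  \<open>F p = (p - sqrt ((p - k)\<^sup>2 + \<epsilon>\<^sup>2) + sqrt (k\<^sup>2 + \<epsilon>\<^sup>2)) / 2\<close>, whose difference quotients are
  given by an explicit continuous function of both arguments.\<close>

lemma truncation_parts:
  assumes k: "k \<ge> 0" and t: "test_fun \<phi>" and d: "\<And>x. (\<phi> has_derivative (\<lambda>h. d\<phi> x \<bullet> h)) (at x)"
  shows "(\<integral>x. min (u x) k * (d\<phi> x \<bullet> b) \<partial>lborel) = - (\<integral>x. (1 - sgn (u x - k)) / 2 * v x * \<phi> x \<partial>lborel)"
proof -
  define e where "e m = inverse (real (Suc m))" for m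
  have e0: "e \<longlonglongrightarrow> 0" unfolding e_def by (rule LIMSEQ_inverse_real_of_nat)
  have ep: "e m > 0" for m by (simp add: e_def)
  define S where "S m p = sqrt ((p - k)\<^sup>2 + (e m)\<^sup>2)" for m p
  \<comment> \<open>The constant \<open>S m 0\<close> normalises \<open>F m 0 = 0\<close>. The
    formula for \<theta> comes from rationalising the difference of the two square roots.\<close>
  define F where "F m p = (p - S m p + S m 0) / 2" for m p
  define \<theta> where "\<theta> m p q = (1 - ((p - k) + (q - k)) / (S m p + S m q)) / 2" for m p q
  have Sp: "S m p > 0" for m p using ep[of m] by (auto simp: S_def intro: add_nonneg_pos)
  have Sge: "\<bar>p - k\<bar> \<le> S m p" for m p unfolding S_def by (rule real_le_rsqrt) simp
  have SS: "(S m p)\<^sup>2 = (p - k)\<^sup>2 + (e m)\<^sup>2" for m p by (simp add: S_def)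
  have F0: "F m 0 = 0" for m by (simp add: F_def)
  have F: "F m p - F m q = \<theta> m p q * (p - q)" for m p q
  proof -
    have "(S m p - S m q) * (S m p + S m q) = (p - q) * ((p - k) + (q - k))"
      using SS[of m p] SS[of m q] by (simp add: algebra_simps power2_eq_square)
    moreover have "S m p + S m q > 0" using Sp[of m p] Sp[of m q] by linarith
    ultimately have "S m p - S m q = ((p - k) + (q - k)) / (S m p + S m q) * (p - q)"
      by (simp add: eq_divide_eq mult.commute)
    then have "(p - q) - (S m p - S m q) = (1 - ((p - k) + (q - k)) / (S m p + S m q)) * (p - q)"
      by (simp only: left_diff_distrib mult_1)
    moreover have "F m p - F m q = ((p - q) - (S m p - S m q)) / 2" by (simp add: F_def field_simps)
    ultimately show ?thesis by (simp only: \<theta>_def times_divide_eq_left)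
  qed
  have \<theta>1: "\<bar>\<theta> m p q\<bar> \<le> 1" for m p q
  proof -
    have "\<bar>(p - k) + (q - k)\<bar> \<le> S m p + S m q" using Sge[of p m] Sge[of q m] by linarith
    then have "\<bar>((p - k) + (q - k)) / (S m p + S m q)\<bar> \<le> 1"
      using Sp[of m p] Sp[of m q] by (simp add: abs_divide)
    moreover have "\<bar>(1 - z) / 2\<bar> \<le> 1" if "\<bar>z\<bar> \<le> 1" for z :: real using that by (auto simp: abs_le_iff)
    ultimately show ?thesis unfolding \<theta>_def by blast
  qed
  have \<theta>c: "continuous_on UNIV (\<lambda>z. \<theta> m (fst z) (snd z))" for m
  proof -
    have "S m p + S m q \<noteq> 0" for p q using Sp[of m p] Sp[of m q] by linarith
    then show ?thesis unfolding \<theta>_def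
      by (auto intro!: continuous_intros simp: S_def)
  qed
  from t d obtain R M where c: "continuous_on UNIV d\<phi>" "continuous_on UNIV \<phi>"
    and supp: "\<And>x. norm x \<ge> R \<Longrightarrow> \<phi> x = 0" "\<And>x. norm x \<ge> R \<Longrightarrow> d\<phi> x = 0"
    and M: "\<And>x. \<bar>\<phi> x\<bar> \<le> M" "\<And>x. norm (d\<phi> x) \<le> M"
    by (rule test_fun_given_gradientE) blast
  note [measurable] = borel_measurable_continuous_onI[OF c(1)] borel_measurable_continuous_onI[OF c(2)]
  have p2: "integrable lborel (\<lambda>x. (\<phi> x)\<^sup>2)" by (rule integrable_bounded_support[of _ R M]) (auto simp: supp M)
  have dp2: "integrable lborel (\<lambda>x. (d\<phi> x \<bullet> b)\<^sup>2)"
    by (rule integrable_bounded_support[of _ R M])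
       (use b Basis_le_norm order_trans M(2) in \<open>auto simp: supp\<close>, blast)
  have \<theta>m[measurable]: "(\<lambda>x. \<theta> m (u x) (u x)) \<in> borel_measurable borel" for m
    by (rule borel_measurable_continuous_Pair[OF u_meas u_meas \<theta>c])
  have Fm[measurable]: "(\<lambda>x. F m (u x)) \<in> borel_measurable borel" for m
    unfolding F_def S_def by measurable
  have Sl: "(\<lambda>m. S m p) \<longlonglongrightarrow> \<bar>p - k\<bar>" for p
  proof -
    have "(\<lambda>m. S m p) \<longlonglongrightarrow> sqrt ((p - k)\<^sup>2 + 0\<^sup>2)" unfolding S_def by (intro tendsto_intros e0)
    then show ?thesis by simp
  qed
  have "(\<lambda>m. \<integral>x. F m (u x) * (d\<phi> x \<bullet> b) \<partial>lborel) \<longlonglongrightarrow> (\<integral>x. min (u x) k * (d\<phi> x \<bullet> b) \<partial>lborel)"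
  proof (rule integral_dominated_convergence[where w = "\<lambda>x. \<bar>u x * (d\<phi> x \<bullet> b)\<bar>"])
    show "integrable lborel (\<lambda>x. \<bar>u x * (d\<phi> x \<bullet> b)\<bar>)"
      by (intro integrable_abs integrable_mult_L2 u2 dp2) auto
    show "AE x in lborel. (\<lambda>m. F m (u x) * (d\<phi> x \<bullet> b)) \<longlonglongrightarrow> min (u x) k * (d\<phi> x \<bullet> b)"
    proof (intro AE_I2 tendsto_mult tendsto_const)
      fix x
      have "(\<lambda>m. F m (u x)) \<longlonglongrightarrow> (u x - \<bar>u x - k\<bar> + \<bar>0 - k\<bar>) / 2"
        unfolding F_def by (intro tendsto_intros Sl) simp
      also have "(u x - \<bar>u x - k\<bar> + \<bar>0 - k\<bar>) / 2 = min (u x) k" using k by (auto simp: min_def)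
      finally show "(\<lambda>m. F m (u x)) \<longlonglongrightarrow> min (u x) k" .
    qed
    have "\<bar>F m p\<bar> \<le> \<bar>p\<bar>" for m p
      using mult_right_mono[OF \<theta>1[of m p 0], of "\<bar>p\<bar>"] F[of m p 0] F0[of m] by (simp add: abs_mult)
    then show "AE x in lborel. norm (F m (u x) * (d\<phi> x \<bullet> b)) \<le> \<bar>u x * (d\<phi> x \<bullet> b)\<bar>" for m
      by (auto simp: abs_mult intro!: mult_right_mono)
  qed measurable
  moreover have "(\<lambda>m. \<integral>x. \<theta> m (u x) (u x) * v x * \<phi> x \<partial>lborel) \<longlonglongrightarrow> (\<integral>x. (1 - sgn (u x - k)) / 2 * v x * \<phi> x \<partial>lborel)"
  proof (rule integral_dominated_convergence[where w = "\<lambda>x. \<bar>v x * \<phi> x\<bar>"])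
    show "integrable lborel (\<lambda>x. \<bar>v x * \<phi> x\<bar>)"
      by (intro integrable_abs integrable_mult_L2 v2 p2) auto
    show "AE x in lborel. (\<lambda>m. \<theta> m (u x) (u x) * v x * \<phi> x) \<longlonglongrightarrow> (1 - sgn (u x - k)) / 2 * v x * \<phi> x"
    proof (intro AE_I2 tendsto_mult tendsto_const)
      fix x
      \<comment> \<open>The diagonal tends to 1 below the level and to 0 above it. On the level
        itself it is constantly 1/2, in agreement with \<open>sgn 0 = 0\<close>.\<close>
      have eq: "\<theta> m p p = (1 - (p - k) / S m p) / 2" for m p
        using Sp[of m p] by (simp add: \<theta>_def field_simps)
      show "(\<lambda>m. \<theta> m (u x) (u x)) \<longlonglongrightarrow> (1 - sgn (u x - k)) / 2"
      proof (cases "u x = k")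
        case True
        then show ?thesis by (simp add: eq)
      next
        case False
        then have "(\<lambda>m. (1 - (u x - k) / S m (u x)) / 2) \<longlonglongrightarrow> (1 - (u x - k) / \<bar>u x - k\<bar>) / 2"
          by (intro tendsto_intros Sl) auto
        then show ?thesis by (simp only: eq real_sgn_eq)
      qed
    qed
    show "AE x in lborel. norm (\<theta> m (u x) (u x) * v x * \<phi> x) \<le> \<bar>v x * \<phi> x\<bar>" for m
      using \<theta>1 by (auto simp: abs_mult mult.assoc intro!: mult_left_le_one_le)
  qed measurable
  ultimately show ?thesis
    unfolding chain_rule[OF F0 F \<theta>c \<theta>1 t d] by (rule LIMSEQ_unique[OF _ tendsto_minus])
qed

end

section \<open>Truncations of Sobolev functions\<close>

text \<open>Stated as an equality of predicates so that the Hilbert choice in \<open>wgrad\<close>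
  returns literally the same function for both representatives.\<close>

lemma L2_grad_cong_AE:
  assumes "AE x in lebesgue. u x = u' x" and [measurable]: "u \<in> borel_measurable lebesgue" "u' \<in> borel_measurable lebesgue"
  shows "L2_grad u = L2_grad u'"
proof -
  have eq: "(\<integral>x. u x * (d\<phi> x \<bullet> b) \<partial>lebesgue) = (\<integral>x. u' x * (d\<phi> x \<bullet> b) \<partial>lebesgue)"
    if t: "test_fun \<phi>" and d: "\<forall>x. (\<phi> has_derivative (\<lambda>h. d\<phi> x \<bullet> h)) (at x)" for \<phi> d\<phi> b
  proof -
    note [measurable] = test_fun_measurable[OF t spec[OF d]]
    show ?thesis by (rule integral_cong_AE) (use assms(1) in auto)
  qed
  have "weak_gradient u g \<longleftrightarrow> weak_gradient u' g" for g
    unfolding weak_gradient_def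
    by (intro iff_allI imp_cong ball_cong refl, elim conjE, subst eq, assumption+, rule refl)
  then show ?thesis by (simp add: L2_grad_def fun_eq_iff)
qed

text \<open>For each coordinate direction \<open>truncation_parts\<close> is applied to Borel
  representatives of u and of that component of g, and the identity is carried back along the null
  sets.\<close>

lemma L2_grad_min:
  fixes u :: "'a::euclidean_space \<Rightarrow> real"
  assumes um: "u \<in> borel_measurable lebesgue" and u2: "integrable lebesgue (\<lambda>x. (u x)\<^sup>2)"
    and g: "L2_grad u g" and k: "k \<ge> 0"
  shows "L2_grad (\<lambda>x. min (u x) k) (\<lambda>x. ((1 - sgn (u x - k)) / 2) *\<^sub>R g x)"
proof -
  note [measurable] = um
  have gm[measurable]: "g \<in> borel_measurable lebesgue" and g2: "integrable lebesgue (\<lambda>x. (norm (g x))\<^sup>2)"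
    and wg: "weak_gradient u g" using g by (auto simp: L2_grad_def)
  obtain u' where u'[measurable]: "u' \<in> borel_measurable borel" and uu: "AE x in lborel. u x = u' x"
    using completion_ex_borel_measurable_real[OF um] by auto
  have uu': "AE x in lebesgue. u x = u' x" using uu by (rule AE_completion)
  have u'l[measurable]: "u' \<in> borel_measurable lebesgue" by (simp add: measurable_completion)
  show ?thesis unfolding L2_grad_def
  proof (intro conjI)
    show hm: "(\<lambda>x. ((1 - sgn (u x - k)) / 2) *\<^sub>R g x) \<in> borel_measurable lebesgue" by measurable
    have "norm (((1 - sgn (u x - k)) / 2) *\<^sub>R g x) \<le> norm (g x)" for x
      by (auto simp: sgn_real_def)
    then show "integrable lebesgue (\<lambda>x. (norm (((1 - sgn (u x - k)) / 2) *\<^sub>R g x))\<^sup>2)"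
      by (intro integrable_L2_dominated[OF measurable_compose[OF hm borel_measurable_norm] g2]) simp
    show "weak_gradient (\<lambda>x. min (u x) k) (\<lambda>x. ((1 - sgn (u x - k)) / 2) *\<^sub>R g x)"
      unfolding weak_gradient_def
    proof (intro allI impI ballI, elim conjE)
      fix \<phi> :: "'a \<Rightarrow> real" and d\<phi> and b :: 'a
      assume t: "test_fun \<phi>" and d: "\<forall>x. (\<phi> has_derivative (\<lambda>h. d\<phi> x \<bullet> h)) (at x)" and b: "b \<in> Basis"
      obtain v where v[measurable]: "v \<in> borel_measurable borel" and gv: "AE x in lborel. g x \<bullet> b = v x"
        using completion_ex_borel_measurable_real[OF L2_grad_component(1)[OF g b]] by auto
      have gv': "AE x in lebesgue. g x \<bullet> b = v x" using gv by (rule AE_completion)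
      have vl[measurable]: "v \<in> borel_measurable lebesgue" by (simp add: measurable_completion)
      interpret weak_partial u' v b
      proof
        have "integrable lebesgue (\<lambda>x. (u' x)\<^sup>2)"
          using u2 by (rule integrable_cong_AE_imp) (use uu' in auto)
        then show "integrable lborel (\<lambda>x. (u' x)\<^sup>2)" by (simp add: integrable_completion)
        have "integrable lebesgue (\<lambda>x. (v x)\<^sup>2)"
          using L2_grad_component(2)[OF g b] by (rule integrable_cong_AE_imp) (use gv' in auto)
        then show "integrable lborel (\<lambda>x. (v x)\<^sup>2)" by (simp add: integrable_completion)
        fix \<psi> :: "'a \<Rightarrow> real" and d\<psi>
        assume t: "test_fun \<psi>" and d: "\<And>x. (\<psi> has_derivative (\<lambda>h. d\<psi> x \<bullet> h)) (at x)"
        note [measurable] = test_fun_measurable[OF t d]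
        have "(\<integral>x. u' x * (d\<psi> x \<bullet> b) \<partial>lborel) = (\<integral>x. u' x * (d\<psi> x \<bullet> b) \<partial>lebesgue)"
          by (simp add: integral_completion)
        also have "\<dots> = (\<integral>x. u x * (d\<psi> x \<bullet> b) \<partial>lebesgue)"
          by (rule integral_cong_AE) (use uu' in auto)
        also have "\<dots> = - (\<integral>x. (g x \<bullet> b) * \<psi> x \<partial>lebesgue)"
          using wg t d b unfolding weak_gradient_def by blast
        also have "(\<integral>x. (g x \<bullet> b) * \<psi> x \<partial>lebesgue) = (\<integral>x. v x * \<psi> x \<partial>lebesgue)"
          by (rule integral_cong_AE) (use gv' in auto)
        finally show "(\<integral>x. u' x * (d\<psi> x \<bullet> b) \<partial>lborel) = - (\<integral>x. v x * \<psi> x \<partial>lborel)"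
          by (simp add: integral_completion)
      qed (use b in auto)
      note [measurable] = test_fun_measurable[OF t spec[OF d]]
      have "(\<integral>x. min (u x) k * (d\<phi> x \<bullet> b) \<partial>lebesgue) = (\<integral>x. min (u' x) k * (d\<phi> x \<bullet> b) \<partial>lebesgue)"
        by (rule integral_cong_AE) (use uu' in auto)
      also have "\<dots> = (\<integral>x. min (u' x) k * (d\<phi> x \<bullet> b) \<partial>lborel)"
        by (rule integral_completion) measurable
      also have "\<dots> = - (\<integral>x. (1 - sgn (u' x - k)) / 2 * v x * \<phi> x \<partial>lborel)"
        by (rule truncation_parts[OF k t]) (use d in auto)
      also have "(\<integral>x. (1 - sgn (u' x - k)) / 2 * v x * \<phi> x \<partial>lborel) = (\<integral>x. (1 - sgn (u' x - k)) / 2 * v x * \<phi> x \<partial>lebesgue)"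
        by (rule integral_completion[symmetric]) measurable
      also have "\<dots> = (\<integral>x. ((1 - sgn (u x - k)) / 2) *\<^sub>R g x \<bullet> b * \<phi> x \<partial>lebesgue)"
        by (rule integral_cong_AE) (use uu' gv' in auto)
      finally show "(\<integral>x. min (u x) k * (d\<phi> x \<bullet> b) \<partial>lebesgue) = - (\<integral>x. ((1 - sgn (u x - k)) / 2) *\<^sub>R g x \<bullet> b * \<phi> x \<partial>lebesgue)" .
    qed
  qed
qed

text \<open>The explicit gradient is \<open>wgrad u\<close> times a factor between 0 and 1;
  uniqueness transfers the bound to the chosen gradient of the truncation.\<close>

lemma min_in_H1:
  assumes "u \<in> H1" "k \<ge> 0"
  shows "(\<lambda>x. min (u x) k) \<in> H1" (is "?v \<in> H1")
    and "AE x in lebesgue. norm (wgrad (\<lambda>x. min (u x) k) x) \<le> norm (wgrad u x)"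
proof -
  from assms have m[measurable]: "u \<in> borel_measurable lebesgue" and u2: "integrable lebesgue (\<lambda>x. (u x)\<^sup>2)"
    by (auto simp: H1_def)
  have g: "L2_grad ?v (\<lambda>x. ((1 - sgn (u x - k)) / 2) *\<^sub>R wgrad u x)"
    by (intro L2_grad_min m u2 L2_grad_wgrad assms)
  have "integrable lebesgue (\<lambda>x. (?v x)\<^sup>2)"
    by (rule integrable_L2_dominated[OF _ u2]) (use assms(2) in auto)
  with g show *: "?v \<in> H1" by (auto simp: H1_def)
  from L2_grad_unique[OF L2_grad_wgrad[OF *] g]
  show "AE x in lebesgue. norm (wgrad ?v x) \<le> norm (wgrad u x)"
    by eventually_elim (auto simp: sgn_real_def)
qed

section \<open>Finiteness of the principal eigenvalue\<close>

text \<open>The bound sums over dyadic annuli; convergence at \<open>0\<close> needs \<open>s < 1\<close>, at infinity \<open>s > 0\<close>.\<close>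

lemma nn_integral_truncated_kernel_finite:
  assumes s: "0 < s" "s < 1"
  shows "(\<integral>\<^sup>+z. ennreal (min ((norm z)\<^sup>2) 1 / norm z powr (real DIM('a) + 2 * s)) \<partial>(lborel :: 'a::euclidean_space measure)) < \<infinity>"
proof -
  define n where "n = real DIM('a)"
  define p where "p = n + 2 * s"
  have n0: "n > 0" and p0: "p > 0" using s by (auto simp: n_def p_def)
  define V where "V = unit_ball_vol n"
  have V0: "V > 0" using n0 by (simp add: V_def)
  \<comment> \<open>For norms in [2^(-j-1), 2^(-j)) the numerator is at most 2^(-2j) and the
    denominator at least 2^(-(j+1)p), which gives \<open>c j\<close>; for norms in [2^j, 2^(j+1))
    the bound is 2^(-jp), that is \<open>d j\<close>. Each annulus is enlarged to the ball
    containing it.\<close>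
  define c where "c j = 2 powr (- 2 * real j + (real j + 1) * p)" for j :: nat
  define d where "d j = 2 powr (- real j * p)" for j :: nat
  have pw: "2 powr real j = 2 ^ j" "2 powr (- real j) = (1/2) ^ j" for j :: nat
    by (simp_all add: powr_realpow powr_minus power_one_over inverse_eq_divide)
  have term_le: "f j \<le> (\<Sum>j. f j)" for f :: "nat \<Rightarrow> ennreal" and j
    using sum_le_suminf[of f "{j}"] by simp
  have le: "ennreal (min ((norm z)\<^sup>2) 1 / norm z powr p) \<le>
      (\<Sum>j. ennreal (c j) * indicator (ball 0 (2 powr (- real j))) z) +
      (\<Sum>j. ennreal (d j) * indicator (ball 0 (2 powr (real j + 1))) z)" for z :: 'a
  proof -
    consider "z = 0" | "z \<noteq> 0" "norm z < 1" | "norm z \<ge> 1" by linarith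
    then show ?thesis
    proof cases
      case 2
      then obtain i where "(1/2 :: real) ^ i \<le> norm z"
        using real_arch_pow_inv[of "norm z" "1/2"] by (auto intro: less_imp_le)
      define i0 where "i0 = (LEAST i. (1/2 :: real) ^ i \<le> norm z)"
      have i0: "(1/2 :: real) ^ i0 \<le> norm z" unfolding i0_def by (rule LeastI) fact
      with 2 obtain j where j: "i0 = Suc j" by (cases i0) auto
      have lt: "norm z < (1/2) ^ j" using not_less_Least[of j "\<lambda>i. (1/2 :: real) ^ i \<le> norm z"] j
        by (auto simp: i0_def[symmetric])
      have "min ((norm z)\<^sup>2) 1 / norm z powr p \<le> ((1/2) ^ j)\<^sup>2 / (2 powr (- (real j + 1))) powr p"
      proof (rule frac_le)
        show "min ((norm z)\<^sup>2) 1 \<le> ((1/2) ^ j)\<^sup>2"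
          using lt by (intro min.coboundedI1 power_mono) auto
        have "2 powr (- (real j + 1)) = (1/2) ^ i0" using pw(2)[of i0] by (simp add: j add.commute)
        then show "(2 powr (- (real j + 1))) powr p \<le> norm z powr p"
          using i0 p0 by (intro powr_mono2) auto
      qed auto
      also have "\<dots> = c j"
      proof -
        have "((1/2) ^ j)\<^sup>2 / (2 powr (- (real j + 1))) powr p = 2 powr ((- real j + - real j) - (- (real j + 1)) * p)"
          by (simp only: pw(2)[symmetric] power2_eq_square powr_add powr_diff powr_powr)
        also have "(- real j + - real j) - (- (real j + 1)) * p = - 2 * real j + (real j + 1) * p"
          by (simp add: algebra_simps)
        finally show ?thesis by (simp only: c_def)
      qed
      finally have "ennreal (min ((norm z)\<^sup>2) 1 / norm z powr p) \<le> ennreal (c j) * indicator (ball 0 (2 powr (- real j))) z"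
        using lt by (simp add: pw ennreal_leI)
      also have "\<dots> \<le> (\<Sum>j. ennreal (c j) * indicator (ball 0 (2 powr (- real j))) z)"
        by (rule term_le)
      finally show ?thesis by (simp add: add_increasing2)
    next
      case 3
      obtain i where "norm z < (2 :: real) ^ i" using real_arch_pow[of 2 "norm z"] by auto
      define i0 where "i0 = (LEAST i. norm z < (2 :: real) ^ i)"
      have i0: "norm z < (2 :: real) ^ i0" unfolding i0_def by (rule LeastI) fact
      with 3 obtain j where j: "i0 = Suc j" by (cases i0) auto
      have ge: "norm z \<ge> 2 ^ j" using not_less_Least[of j "\<lambda>i. norm z < (2 :: real) ^ i"] j
        by (auto simp: i0_def[symmetric])
      have "min ((norm z)\<^sup>2) 1 / norm z powr p \<le> 1 / (2 powr real j) powr p"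
        using ge p0 by (intro frac_le powr_mono2) (auto simp: pw)
      also have "\<dots> = d j" by (simp add: d_def powr_powr powr_minus divide_inverse)
      finally have "ennreal (min ((norm z)\<^sup>2) 1 / norm z powr p) \<le> ennreal (d j) * indicator (ball 0 (2 powr (real j + 1))) z"
        using i0 pw(1)[of i0] by (simp add: j ennreal_leI add.commute)
      also have "\<dots> \<le> (\<Sum>j. ennreal (d j) * indicator (ball 0 (2 powr (real j + 1))) z)"
        by (rule term_le)
      finally show ?thesis by (simp add: add_increasing)
    qed auto
  qed
  have ball: "emeasure lborel (ball (0::'a) (2 powr r)) = ennreal (V * 2 powr (r * n))" for r
    by (simp add: emeasure_ball V_def n_def powr_powr[symmetric] powr_realpow)
  have geo: "(\<Sum>j. ennreal (C * q ^ j)) < \<infinity>" if "0 \<le> C" "0 \<le> q" "q < 1" for C q :: real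
  proof -
    have "(\<Sum>j. ennreal (C * q ^ j)) = ennreal (\<Sum>j. C * q ^ j)"
      using that by (intro suminf_ennreal2 summable_mult summable_geometric) auto
    then show ?thesis by simp
  qed
  have "(\<integral>\<^sup>+z. ennreal (min ((norm z)\<^sup>2) 1 / norm z powr p) \<partial>(lborel :: 'a measure)) \<le>
     (\<integral>\<^sup>+z. (\<Sum>j. ennreal (c j) * indicator (ball 0 (2 powr (- real j))) z) +
        (\<Sum>j. ennreal (d j) * indicator (ball 0 (2 powr (real j + 1))) z) \<partial>(lborel :: 'a measure))"
    by (rule nn_integral_mono) (rule le)
  also have "\<dots> = (\<Sum>j. ennreal (c j) * emeasure lborel (ball (0::'a) (2 powr (- real j)))) +
       (\<Sum>j. ennreal (d j) * emeasure lborel (ball (0::'a) (2 powr (real j + 1))))"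
  proof -
    have m: "(\<lambda>z::'a. a * indicator (ball 0 r) z) \<in> borel_measurable lborel" for a :: ennreal and r :: real
      by (intro borel_measurable_times_ennreal borel_measurable_const borel_measurable_indicator) simp
    have i: "(\<integral>\<^sup>+z. (\<Sum>j. a j * indicator (ball 0 (r j)) z) \<partial>(lborel :: 'a measure)) =
        (\<Sum>j. a j * emeasure lborel (ball (0::'a) (r j)))" for a :: "nat \<Rightarrow> ennreal" and r
      by (subst nn_integral_suminf[OF m]) (simp add: nn_integral_cmult_indicator)
    show ?thesis
      by (subst nn_integral_add) (simp_all only: i borel_measurable_suminf_order m)
  qed
  \<comment> \<open>Weight times ball volume is geometric in j: since p = n + 2s, the dimension
    cancels and the ratios are 2^(-(2 - 2s)) and 2^(-2s).\<close>
  also have "\<dots> = (\<Sum>j. ennreal (V * 2 powr p * (2 powr (- (2 - 2 * s))) ^ j)) + (\<Sum>j. ennreal (V * 2 powr n * (2 powr (- 2 * s)) ^ j))"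
  proof -
    have pj: "(2 powr a) ^ j = 2 powr (a * real j)" for a :: real and j :: nat
      by (subst powr_realpow[symmetric]) (simp_all add: powr_powr)
    have ceq: "c j * (V * 2 powr (- real j * n)) = V * 2 powr p * (2 powr (- (2 - 2 * s))) ^ j" for j
    proof -
      have "(2 powr (- (2 - 2 * s))) ^ j = 2 powr (- (2 - 2 * s) * real j)" by (rule pj)
      moreover have "- 2 * real j + (real j + 1) * p + - real j * n = p + - (2 - 2 * s) * real j"
        by (simp add: p_def algebra_simps)
      then have "2 powr (- 2 * real j + (real j + 1) * p) * 2 powr (- real j * n) = 2 powr p * 2 powr (- (2 - 2 * s) * real j)"
        by (simp only: powr_add[symmetric])
      ultimately show ?thesis by (simp add: c_def mult_ac)
    qed
    have deq: "d j * (V * 2 powr ((real j + 1) * n)) = V * 2 powr n * (2 powr (- 2 * s)) ^ j" for j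
    proof -
      have "(2 powr (- 2 * s)) ^ j = 2 powr (- 2 * s * real j)" by (rule pj)
      moreover have "- real j * p + (real j + 1) * n = n + - 2 * s * real j"
        by (simp add: p_def algebra_simps)
      then have "2 powr (- real j * p) * 2 powr ((real j + 1) * n) = 2 powr n * 2 powr (- 2 * s * real j)"
        by (simp only: powr_add[symmetric])
      ultimately show ?thesis by (simp add: d_def mult_ac)
    qed
    have "ennreal (c j) * ennreal (V * 2 powr (- real j * n)) = ennreal (V * 2 powr p * (2 powr (- (2 - 2 * s))) ^ j)"
      "ennreal (d j) * ennreal (V * 2 powr ((real j + 1) * n)) = ennreal (V * 2 powr n * (2 powr (- 2 * s)) ^ j)" for j
      unfolding ceq[symmetric] deq[symmetric] using V0
      by (intro ennreal_mult[symmetric]; simp add: c_def d_def)+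
    then show ?thesis unfolding ball by (simp only:)
  qed
  also have "\<dots> < \<infinity>"
  proof -
    have "2 powr (- (2 - 2 * s)) < 1" "2 powr (- 2 * s) < 1"
      using s by (auto simp: powr_less_one)
    then have "(\<Sum>j. ennreal (V * 2 powr p * (2 powr (- (2 - 2 * s))) ^ j)) < \<infinity>"
      "(\<Sum>j. ennreal (V * 2 powr n * (2 powr (- 2 * s)) ^ j)) < \<infinity>"
      using V0 by (intro geo; simp)+
    then show ?thesis by (simp only: infinity_ennreal_def ennreal_add_less_top)
  qed
  finally show ?thesis by (simp add: p_def n_def)
qed

text \<open>The Lipschitz and sup bounds together dominate the squared increment by a multiple of
  the truncated square of |x - y|. The integrand vanishes unless x or y lies in the support ball, so
  one variable ranges over a bounded set while the kernel is integrated in the other.\<close>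

lemma test_fun_nonlocal_energy_finite:
  fixes \<phi> :: "'a::euclidean_space \<Rightarrow> real"
  assumes s: "0 < s" "s < 1" and t: "test_fun \<phi>"
  shows "(\<integral>\<^sup>+x. \<integral>\<^sup>+y. ennreal ((\<phi> x - \<phi> y)\<^sup>2 / dist x y powr (real DIM('a) + 2 * s)) \<partial>lborel \<partial>lborel) < \<infinity>"
proof -
  define p where "p = real DIM('a) + 2 * s"
  define \<kappa> where "\<kappa> z = ennreal (min ((norm z)\<^sup>2) 1 / norm z powr p)" for z :: 'a
  have [measurable]: "\<kappa> \<in> borel_measurable borel" unfolding \<kappa>_def by measurable
  define I where "I = (\<integral>\<^sup>+z. \<kappa> z \<partial>lborel)"
  have I: "I < \<infinity>" unfolding I_def \<kappa>_def p_def by (rule nn_integral_truncated_kernel_finite[OF s])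
  from t obtain R M where supp: "\<And>x. norm x \<ge> R \<Longrightarrow> \<phi> x = 0" and M0: "M > 0"
    and M: "\<And>x. \<bar>\<phi> x\<bar> \<le> M" and Lip: "\<And>x y. \<bar>\<phi> x - \<phi> y\<bar> \<le> M * norm (x - y)"
    by (rule test_fun_gradientE) blast
  define B where "B = (indicator (ball 0 R) :: 'a \<Rightarrow> ennreal)"
  have [measurable]: "B \<in> borel_measurable borel" unfolding B_def by (rule borel_measurable_indicator) simp
  have fB: "(\<integral>\<^sup>+x. B x \<partial>lborel) < \<infinity>"
    using emeasure_bounded_finite[OF bounded_ball[of "0::'a" R]] by (simp add: B_def)
  have le: "ennreal ((\<phi> x - \<phi> y)\<^sup>2 / dist x y powr p) \<le> ennreal (4 * M\<^sup>2) * (B x * \<kappa> (y - x) + B y * \<kappa> (y - x))" for x y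
  proof (cases "x \<in> ball 0 R \<or> y \<in> ball 0 R")
    case False
    then have "\<phi> x = 0" "\<phi> y = 0" using supp by (auto simp: not_less)
    then show ?thesis by simp
  next
    case True
    have "(\<phi> x - \<phi> y)\<^sup>2 \<le> (M * norm (y - x))\<^sup>2"
      using Lip[of x y] M0 by (intro power2_le_iff_abs_le[THEN iffD2]) (auto simp: norm_minus_commute)
    also have "\<dots> \<le> 4 * M\<^sup>2 * (norm (y - x))\<^sup>2" by (simp add: power_mult_distrib)
    finally have 1: "(\<phi> x - \<phi> y)\<^sup>2 \<le> 4 * M\<^sup>2 * (norm (y - x))\<^sup>2" .
    have "(\<phi> x - \<phi> y)\<^sup>2 \<le> (2 * M)\<^sup>2"
      using M[of x] M[of y] M0 by (intro power2_le_iff_abs_le[THEN iffD2]) auto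
    with 1 have "(\<phi> x - \<phi> y)\<^sup>2 \<le> 4 * M\<^sup>2 * min ((norm (y - x))\<^sup>2) 1"
      by (simp add: min_def power_mult_distrib)
    then have "(\<phi> x - \<phi> y)\<^sup>2 / dist x y powr p \<le> 4 * M\<^sup>2 * min ((norm (y - x))\<^sup>2) 1 / norm (y - x) powr p"
      by (simp add: dist_norm norm_minus_commute divide_right_mono)
    then have "ennreal ((\<phi> x - \<phi> y)\<^sup>2 / dist x y powr p) \<le> ennreal (4 * M\<^sup>2 * (min ((norm (y - x))\<^sup>2) 1 / norm (y - x) powr p))"
      by (simp add: ennreal_leI)
    also have "\<dots> = ennreal (4 * M\<^sup>2) * \<kappa> (y - x)"
      unfolding \<kappa>_def by (rule ennreal_mult) auto
    also have "\<dots> \<le> ennreal (4 * M\<^sup>2) * (B x * \<kappa> (y - x) + B y * \<kappa> (y - x))"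
      using True by (intro mult_left_mono) (auto simp: B_def add_increasing add_increasing2)
    finally show ?thesis .
  qed
  have inner1: "(\<integral>\<^sup>+y. \<kappa> (y - x) \<partial>lborel) = I" for x
    unfolding I_def using nn_integral_lborel_translate[of \<kappa> "-x"] by simp
  have inner2: "(\<integral>\<^sup>+x. \<kappa> (y - x) \<partial>lborel) = I" for y
  proof -
    have "\<kappa> (y - x) = \<kappa> (x - y)" for x by (simp add: \<kappa>_def norm_minus_commute)
    then show ?thesis using inner1[of y] by simp
  qed
  have "(\<integral>\<^sup>+x. \<integral>\<^sup>+y. ennreal ((\<phi> x - \<phi> y)\<^sup>2 / dist x y powr p) \<partial>lborel \<partial>lborel) \<le>
    (\<integral>\<^sup>+x. \<integral>\<^sup>+y. ennreal (4 * M\<^sup>2) * (B x * \<kappa> (y - x) + B y * \<kappa> (y - x)) \<partial>lborel \<partial>lborel)"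
    by (intro nn_integral_mono le)
  also have "\<dots> = ennreal (4 * M\<^sup>2) * ((\<integral>\<^sup>+x. \<integral>\<^sup>+y. B x * \<kappa> (y - x) \<partial>lborel \<partial>lborel) +
        (\<integral>\<^sup>+x. \<integral>\<^sup>+y. B y * \<kappa> (y - x) \<partial>lborel \<partial>lborel))"
    by (simp add: nn_integral_cmult nn_integral_add)
  also have "(\<integral>\<^sup>+x. \<integral>\<^sup>+y. B x * \<kappa> (y - x) \<partial>lborel \<partial>lborel) = (\<integral>\<^sup>+x. B x \<partial>lborel) * I"
    by (simp add: nn_integral_cmult inner1 nn_integral_multc)
  also have "(\<integral>\<^sup>+x. \<integral>\<^sup>+y. B y * \<kappa> (y - x) \<partial>lborel \<partial>lborel) = (\<integral>\<^sup>+y. \<integral>\<^sup>+x. B y * \<kappa> (y - x) \<partial>lborel \<partial>lborel)"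
    by (rule lborel_pair.Fubini') measurable
  also have "\<dots> = (\<integral>\<^sup>+x. B x \<partial>lborel) * I"
    by (simp add: nn_integral_cmult inner2 nn_integral_multc)
  also have "ennreal (4 * M\<^sup>2) * ((\<integral>\<^sup>+x. B x \<partial>lborel) * I + (\<integral>\<^sup>+x. B x \<partial>lborel) * I) < \<infinity>"
    using fB I by (simp add: ennreal_mult_less_top)
  finally show ?thesis by (simp add: p_def)
qed

text \<open>Integration by parts for two test functions comes from translation invariance: pairing
  backward difference quotients of one in direction b with the other equals pairing the quotients of
  the other in direction -b with the first, and both sides converge.\<close>

lemma test_fun_L2_grad:
  fixes \<phi> :: "'a::euclidean_space \<Rightarrow> real"
  assumes t: "test_fun \<phi>" and d: "\<And>x. (\<phi> has_derivative (\<lambda>h. d\<phi> x \<bullet> h)) (at x)"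
  shows "L2_grad \<phi> d\<phi>" "integrable lborel (\<lambda>x. (\<phi> x)\<^sup>2)"
proof -
  have L2: "integrable lborel (\<lambda>x. (\<psi> x)\<^sup>2)" "integrable lborel (\<lambda>x. (norm (d\<psi> x))\<^sup>2)"
    if t: "test_fun \<psi>" and d: "\<And>x. (\<psi> has_derivative (\<lambda>h. d\<psi> x \<bullet> h)) (at x)" for \<psi> :: "'a \<Rightarrow> real" and d\<psi>
  proof -
    note [measurable] = test_fun_measurable[OF t d]
    from t d obtain R M where "\<And>x. norm x \<ge> R \<Longrightarrow> \<psi> x = 0" "\<And>x. norm x \<ge> R \<Longrightarrow> d\<psi> x = 0"
      "\<And>x. \<bar>\<psi> x\<bar> \<le> M" "\<And>x. norm (d\<psi> x) \<le> M" by (rule test_fun_given_gradientE) blast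
    then show "integrable lborel (\<lambda>x. (\<psi> x)\<^sup>2)" "integrable lborel (\<lambda>x. (norm (d\<psi> x))\<^sup>2)"
      by (auto intro!: integrable_bounded_support[of _ R M])
  qed
  show "integrable lborel (\<lambda>x. (\<phi> x)\<^sup>2)" by (rule L2[OF t d])
  note m = test_fun_measurable[OF t d]
  note [measurable] = m
  have "weak_gradient \<phi> d\<phi>"
    unfolding weak_gradient_def
  proof (intro allI impI ballI, elim conjE)
    fix \<psi> :: "'a \<Rightarrow> real" and d\<psi> and b :: 'a
    assume t': "test_fun \<psi>" and d': "\<forall>x. (\<psi> has_derivative (\<lambda>h. d\<psi> x \<bullet> h)) (at x)" and b: "b \<in> Basis"
    have nb: "norm b = 1" "norm (- b) = 1" using b by auto
    note [measurable] = test_fun_measurable[OF t' spec[OF d']]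
    note L2' = L2[OF t' spec[OF d']]
    have eq: "(\<integral>x. \<psi> x * ((\<phi> x - \<phi> (x - (1/2) ^ m *\<^sub>R b)) / (1/2) ^ m) \<partial>lborel) =
          (\<integral>x. \<phi> x * ((\<psi> x - \<psi> (x - (1/2) ^ m *\<^sub>R (- b))) / (1/2) ^ m) \<partial>lborel)" for m :: nat
    proof -
      let ?c = "(1/2) ^ m *\<^sub>R b"
      have sh: "integrable lborel (\<lambda>x. (\<phi> (x - ?c))\<^sup>2)" "integrable lborel (\<lambda>x. (\<psi> (x + ?c))\<^sup>2)"
        using integrable_lborel_translate[of "\<lambda>x. (\<phi> x)\<^sup>2" "- ?c"] L2(1)[OF t d]
          integrable_lborel_translate[of "\<lambda>x. (\<psi> x)\<^sup>2" "?c"] L2'(1) by simp_all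
      have i: "integrable lborel (\<lambda>x. \<psi> x * \<phi> x)" "integrable lborel (\<lambda>x. \<psi> x * \<phi> (x - ?c))"
         "integrable lborel (\<lambda>x. \<phi> x * \<psi> (x + ?c))"
        by (intro integrable_mult_L2 L2' L2(1)[OF t d] sh; measurable)+
      have "(\<integral>x. \<psi> x * (\<phi> x - \<phi> (x - ?c)) \<partial>lborel) = (\<integral>x. \<psi> x * \<phi> x \<partial>lborel) - (\<integral>x. \<psi> x * \<phi> (x - ?c) \<partial>lborel)"
        using i by (simp add: right_diff_distrib)
      also have "(\<integral>x. \<psi> x * \<phi> (x - ?c) \<partial>lborel) = (\<integral>x. \<psi> (x + ?c) * \<phi> x \<partial>lborel)"
        using integral_lborel_translate[of "\<lambda>x. \<psi> x * \<phi> (x - ?c)" "?c"] by simp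
      also have "(\<integral>x. \<psi> x * \<phi> x \<partial>lborel) - \<dots> = (\<integral>x. \<phi> x * (\<psi> x - \<psi> (x + ?c)) \<partial>lborel)"
        using i by (simp add: right_diff_distrib mult.commute)
      finally show ?thesis by simp
    qed
    have "(\<integral>x. \<psi> x * (d\<phi> x \<bullet> b) \<partial>lborel) = (\<integral>x. \<phi> x * (d\<psi> x \<bullet> (- b)) \<partial>lborel)"
      by (rule LIMSEQ_unique[OF difference_quotient_tendsto[OF _ L2'(1) t d nb(1)]
             difference_quotient_tendsto[OF _ L2(1)[OF t d] t' spec[OF d'] nb(2), folded eq]]) measurable
    then have "(\<integral>x. \<phi> x * (d\<psi> x \<bullet> b) \<partial>lborel) = - (\<integral>x. d\<phi> x \<bullet> b * \<psi> x \<partial>lborel)"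
      by (simp add: mult.commute)
    then show "(\<integral>x. \<phi> x * (d\<psi> x \<bullet> b) \<partial>lebesgue) = - (\<integral>x. d\<phi> x \<bullet> b * \<psi> x \<partial>lebesgue)"
      by (simp add: integral_completion)
  qed
  then show "L2_grad \<phi> d\<phi>"
    unfolding L2_grad_def using L2(2)[OF t d] by (simp add: integrable_completion)
qed

text \<open>A bump supported in a box inside the domain is an admissible competitor of finite energy
  and positive norm.\<close>

lemma lambdaL_finite:
  fixes \<Omega> :: "'a::euclidean_space set"
  assumes s: "0 < s" "s < 1" and \<Omega>: "open \<Omega>" "\<Omega> \<noteq> {}"
  shows "lambdaL \<Omega> s < \<infinity>"
proof -
  obtain x0 where "x0 \<in> \<Omega>" using \<Omega> by auto
  obtain a d where ad: "box a d \<subseteq> \<Omega>" "x0 \<in> box a d"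
    by (rule open_contains_box[OF \<Omega>(1) \<open>x0 \<in> \<Omega>\<close>])
  define \<phi> where "\<phi> = box_bump a d 0"
  have t: "test_fun \<phi>" unfolding \<phi>_def by (rule test_fun_box_bump)
  then obtain d\<phi> where d: "\<And>x. (\<phi> has_derivative (\<lambda>h. d\<phi> x \<bullet> h)) (at x)"
    by (rule test_fun_gradientE) blast
  note [measurable] = test_fun_measurable[OF t d]
  have H: "\<phi> \<in> H1"
    using test_fun_L2_grad[OF t d] unfolding H1_def by (auto simp: integrable_completion)
  have X: "\<phi> \<in> XOmega \<Omega>" using H ad box_bump_eq_0[of _ a d 0] by (auto simp: XOmega_def \<phi>_def)
  have nz: "\<not> (AE x in lebesgue. \<phi> x = 0)"
  proof
    assume "AE x in lebesgue. \<phi> x = 0"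
    then have "AE x in lebesgue. x \<notin> box a d"
      by eventually_elim (use box_bump_pos[of _ a d 0] in \<open>force simp: \<phi>_def\<close>)
    then have "box a d \<in> null_sets lebesgue" by (subst (asm) AE_iff_null_sets[symmetric]) auto
    then have "negligible (box a d)" by (simp add: negligible_iff_null_sets)
    with ad(2) show False using open_not_negligible[of "box a d"] by auto
  qed
  have "Denergy \<Omega> s \<phi> < \<infinity>"
  proof -
    have "(\<integral>\<^sup>+x. indicator \<Omega> x * ennreal ((norm (wgrad \<phi> x))\<^sup>2) \<partial>lebesgue) \<le> (\<integral>\<^sup>+x. ennreal ((norm (wgrad \<phi> x))\<^sup>2) \<partial>lebesgue)"
      by (rule nn_integral_mono) (auto simp: indicator_def)
    also have "\<dots> < \<infinity>"
    proof -
      have "L2_grad \<phi> (wgrad \<phi>)" using H by (rule L2_grad_wgrad)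
      then show ?thesis by (simp add: L2_grad_def nn_integral_eq_integral less_top[symmetric])
    qed
    finally show ?thesis
      using test_fun_nonlocal_energy_finite[OF s t] by (simp add: Denergy_def nn_integral_completion)
  qed
  moreover have "L2sq_on \<Omega> \<phi> > 0"
  proof -
    have "(indicator \<Omega> x * (\<phi> x)\<^sup>2 :: real) = (\<phi> x)\<^sup>2" for x
      using ad box_bump_eq_0[of x a d 0] by (auto simp: indicator_def \<phi>_def)
    then have "L2sq_on \<Omega> \<phi> = (\<integral>x. (\<phi> x)\<^sup>2 \<partial>lebesgue)" unfolding L2sq_on_def by (simp only:)
    moreover have "\<dots> \<noteq> 0"
      using nz integral_nonneg_eq_0_iff_AE[of lebesgue "\<lambda>x. (\<phi> x)\<^sup>2"] H by (auto simp: H1_def)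
    moreover have "(\<integral>x. (\<phi> x)\<^sup>2 \<partial>lebesgue) \<ge> 0" by simp
    ultimately show ?thesis by linarith
  qed
  ultimately have "Denergy \<Omega> s \<phi> / ennreal (L2sq_on \<Omega> \<phi>) < \<infinity>"
    by (simp add: ennreal_divide_eq_top_iff less_top[symmetric])
  moreover have "lambdaL \<Omega> s \<le> Denergy \<Omega> s \<phi> / ennreal (L2sq_on \<Omega> \<phi>)"
    unfolding lambdaL_def by (rule INF_lower) (use X nz in auto)
  ultimately show ?thesis by (rule le_less_trans[rotated])
qed

section \<open>Boundedness by level-set iteration\<close>

text \<open>The second summand of \<open>Denergy\<close>, taken over \<open>lborel\<close> because
  the level-set argument works with a Borel representative; passing to the completion does not
  change nonnegative integrals.\<close>

definition nonlocal_energy :: "real \<Rightarrow> ('a::euclidean_space \<Rightarrow> real) \<Rightarrow> ennreal" where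
  "nonlocal_energy s u =
     (\<integral>\<^sup>+x. \<integral>\<^sup>+y. ennreal ((u x - u y)\<^sup>2 / dist x y powr (real DIM('a) + 2 * s)) \<partial>lborel \<partial>lborel)"

text \<open>The increments of the two parts never have opposite signs, so the cross term in the
  square of their sum is nonnegative.\<close>

lemma nonlocal_energy_split:
  fixes u :: "'a::euclidean_space \<Rightarrow> real"
  assumes [measurable]: "u \<in> borel_measurable borel"
  shows "nonlocal_energy s (\<lambda>x. min (u x) k) + nonlocal_energy s (\<lambda>x. max (u x - k) 0) \<le> nonlocal_energy s u"
proof -
  define p where "p = real DIM('a) + 2 * s"
  have le: "(min a k - min b k)\<^sup>2 + (max (a - k) 0 - max (b - k) 0)\<^sup>2 \<le> (a - b)\<^sup>2" for a b :: real
  proof -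
    have "X\<^sup>2 + Y\<^sup>2 \<le> (X + Y)\<^sup>2" if "0 \<le> X * Y" for X Y :: real
      using that unfolding power2_sum by linarith
    moreover have "0 \<le> (min a k - min b k) * (max (a - k) 0 - max (b - k) 0)"
      by (cases "a \<le> b") (auto simp: min_def max_def intro!: mult_nonneg_nonneg mult_nonpos_nonpos)
    moreover have "a - b = (min a k - min b k) + (max (a - k) 0 - max (b - k) 0)" by (auto simp: min_def max_def)
    ultimately show ?thesis by metis
  qed
  have "nonlocal_energy s (\<lambda>x. min (u x) k) + nonlocal_energy s (\<lambda>x. max (u x - k) 0) =
    (\<integral>\<^sup>+x. \<integral>\<^sup>+y. ennreal ((min (u x) k - min (u y) k)\<^sup>2 / dist x y powr p) +
        ennreal ((max (u x - k) 0 - max (u y - k) 0)\<^sup>2 / dist x y powr p) \<partial>lborel \<partial>lborel)"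
    unfolding nonlocal_energy_def p_def by (subst nn_integral_add[symmetric]; (subst nn_integral_add[symmetric])?; measurable)
  also have "\<dots> \<le> (\<integral>\<^sup>+x. \<integral>\<^sup>+y. ennreal ((u x - u y)\<^sup>2 / dist x y powr p) \<partial>lborel \<partial>lborel)"
  proof (intro nn_integral_mono)
    fix x y
    have "(min (u x) k - min (u y) k)\<^sup>2 / dist x y powr p + (max (u x - k) 0 - max (u y - k) 0)\<^sup>2 / dist x y powr p
        \<le> (u x - u y)\<^sup>2 / dist x y powr p"
      unfolding add_divide_distrib[symmetric] by (intro divide_right_mono le) simp
    then show "ennreal ((min (u x) k - min (u y) k)\<^sup>2 / dist x y powr p) +
        ennreal ((max (u x - k) 0 - max (u y - k) 0)\<^sup>2 / dist x y powr p) \<le> ennreal ((u x - u y)\<^sup>2 / dist x y powr p)"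
      by (subst ennreal_plus[symmetric]) (simp_all del: ennreal_plus add: ennreal_leI)
  qed
  finally show ?thesis by (simp add: nonlocal_energy_def p_def)
qed

text \<open>For \<open>x\<close> in the support \<open>A\<close> of \<open>w\<close>, a ball around \<open>x\<close> of volume \<open>2 |A|\<close> contains at least \<open>|A|\<close>
  outside \<open>A\<close>; restricting the energy to such pairs already controls the \<open>L\<^sup>2\<close> norm.\<close>

lemma fractional_Faber_Krahn:
  fixes w :: "'a::euclidean_space \<Rightarrow> real"
  defines "V \<equiv> unit_ball_vol (real DIM('a))"
  assumes [measurable]: "w \<in> borel_measurable borel"
    and A: "emeasure lborel {x. w x \<noteq> 0} = ennreal a" and a: "a > 0" and s: "s > 0"
  shows "ennreal (V / 2 * (2 * a / V) powr (- (2 * s / real DIM('a)))) * (\<integral>\<^sup>+x. ennreal ((w x)\<^sup>2) \<partial>lborel) \<le> nonlocal_energy s w"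
proof -
  define n where "n = real DIM('a)"
  define p where "p = n + 2 * s"
  have n: "n > 0" by (simp add: n_def)
  have V: "V > 0" using n by (simp add: V_def n_def)
  have p: "p > 0" using n s by (simp add: p_def)
  define S where "S = {x. w x \<noteq> 0}"
  have [measurable]: "S \<in> sets borel" unfolding S_def by measurable
  define R where "R = (2 * a / V) powr (1 / n)"
  have R: "R > 0" using a V by (simp add: R_def)
  have Rn: "V * R ^ DIM('a) = 2 * a"
  proof -
    have "R ^ DIM('a) = R powr n" using R by (simp add: n_def powr_realpow)
    also have "\<dots> = 2 * a / V" using a V n by (simp add: R_def powr_powr)
    finally show ?thesis using V by simp
  qed
  \<comment> \<open>On the ball of radius R the kernel is at least \<open>R powr (- p)\<close>;
    multiplied by the measure a outside the support, this is the constant of the claim.\<close>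
  have ceq: "R powr (- p) * a = V / 2 * (2 * a / V) powr (- (2 * s / n))"
  proof -
    have "R powr (- p) = (2 * a / V) powr (- 1 + - (2 * s / n))"
      unfolding R_def powr_powr using n by (simp add: p_def field_simps)
    also have "\<dots> = (2 * a / V) powr (- 1) * (2 * a / V) powr (- (2 * s / n))" by (rule powr_add)
    also have "(2 * a / V) powr (- 1) = V / (2 * a)" using a V by (simp add: powr_minus)
    finally show ?thesis using a by simp
  qed
  have inner: "ennreal (R powr (- p) * a) * ennreal ((w x)\<^sup>2) \<le> (\<integral>\<^sup>+y. ennreal ((w x - w y)\<^sup>2 / dist x y powr p) \<partial>lborel)" for x
  proof (cases "x \<in> S")
    case False
    then show ?thesis by (simp add: S_def)
  next
    case True
    have "ennreal a \<le> emeasure lborel (ball x R - S)"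
    proof -
      have "ennreal (2 * a) = emeasure lborel (ball x R)"
        using R Rn by (simp add: emeasure_ball V_def)
      also have "\<dots> \<le> emeasure lborel ((ball x R - S) \<union> S)" by (rule emeasure_mono) auto
      also have "\<dots> \<le> emeasure lborel (ball x R - S) + ennreal a"
        using A by (metis S_def emeasure_subadditive \<open>S \<in> sets borel\<close> sets.Diff borel_open open_ball sets_lborel)
      finally have "ennreal a + ennreal a \<le> emeasure lborel (ball x R - S) + ennreal a"
        using a by (simp add: ennreal_plus[symmetric] del: ennreal_plus)
      then show ?thesis by (simp add: add.commute)
    qed
    then have "ennreal (R powr (- p) * a) * ennreal ((w x)\<^sup>2) \<le> ennreal (R powr (- p) * (w x)\<^sup>2) * emeasure lborel (ball x R - S)"
    proof -
      have "ennreal (R powr (- p) * a) * ennreal ((w x)\<^sup>2) = ennreal (R powr (- p) * (w x)\<^sup>2) * ennreal a"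
        using a by (simp add: ennreal_mult[symmetric] mult_ac)
      also have "\<dots> \<le> ennreal (R powr (- p) * (w x)\<^sup>2) * emeasure lborel (ball x R - S)"
        by (rule mult_left_mono) (fact, simp)
      finally show ?thesis .
    qed
    also have "\<dots> = (\<integral>\<^sup>+y. ennreal (R powr (- p) * (w x)\<^sup>2) * indicator (ball x R - S) y \<partial>lborel)"
      by (rule nn_integral_cmult_indicator[symmetric]) simp
    also have "\<dots> \<le> (\<integral>\<^sup>+y. ennreal ((w x - w y)\<^sup>2 / dist x y powr p) \<partial>lborel)"
    proof (rule nn_integral_mono)
      fix y
      show "ennreal (R powr (- p) * (w x)\<^sup>2) * indicator (ball x R - S) y \<le> ennreal ((w x - w y)\<^sup>2 / dist x y powr p)"
      proof (cases "y \<in> ball x R - S")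
        case y: True
        \<comment> \<open>\<open>x \<noteq> y\<close> is essential: on the diagonal the quotient is
          a division by zero and has the value 0.\<close>
        then have wy: "w y = 0" and "x \<noteq> y" and "dist x y < R" using True by (auto simp: S_def)
        then have "dist x y powr p \<le> R powr p" "0 < dist x y powr p" using p by (auto intro!: powr_mono2)
        then have "(w x)\<^sup>2 / R powr p \<le> (w x)\<^sup>2 / dist x y powr p" using R by (intro divide_left_mono mult_pos_pos) auto
        with y wy show ?thesis by (simp add: powr_minus divide_inverse mult.commute ennreal_leI)
      qed simp
    qed
    finally show ?thesis .
  qed
  have "ennreal (V / 2 * (2 * a / V) powr (- (2 * s / n))) * (\<integral>\<^sup>+x. ennreal ((w x)\<^sup>2) \<partial>lborel) =
      (\<integral>\<^sup>+x. ennreal (R powr (- p) * a) * ennreal ((w x)\<^sup>2) \<partial>lborel)"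
    by (simp add: nn_integral_cmult ceq)
  also have "\<dots> \<le> nonlocal_energy s w"
    unfolding nonlocal_energy_def n_def[symmetric] p_def[symmetric] by (intro nn_integral_mono inner)
  finally show ?thesis by (simp add: n_def)
qed

section \<open>De Giorgi iteration over the levels\<close>

text \<open>q is chosen so that the gain q^(j \<beta>) = 4^(-j) cancels the growth 4^j, and
  smallness of the initial value supplies one more factor q. The recursion is assumed only where
  \<open>y j \<le> y 0\<close>, since it will hold only for small level sets; the induction
  preserves this condition.\<close>

lemma fast_geometric_decay:
  fixes y :: "nat \<Rightarrow> real"
  assumes nn: "\<And>j. 0 \<le> y j" and B: "0 \<le> B" and q: "0 < q" "q \<le> 1" "q powr \<beta> = 1 / 4" and \<beta>: "\<beta> > 0"
    and step: "\<And>j. y j \<le> y 0 \<Longrightarrow> y (Suc j) \<le> B * 4 ^ j * y j * y j powr \<beta>"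
    and small: "B * y 0 powr \<beta> \<le> q"
  shows "y j \<le> y 0 * q ^ j"
proof (induction j)
  case (Suc j)
  have "y 0 * q ^ j \<le> y 0" using nn[of 0] q by (simp add: mult_left_le power_le_one)
  with Suc have "y j \<le> y 0" by simp
  from step[OF this] have "y (Suc j) \<le> B * 4 ^ j * y j * y j powr \<beta>" .
  also have "\<dots> \<le> B * 4 ^ j * (y 0 * q ^ j) * (y 0 * q ^ j) powr \<beta>"
    using Suc nn B q \<beta> by (intro mult_mono powr_mono2) auto
  also have "(y 0 * q ^ j) powr \<beta> = y 0 powr \<beta> * (1 / 4) ^ j"
  proof -
    have "(q ^ j) powr \<beta> = (q powr \<beta>) ^ j"
      using q by (simp add: powr_realpow[symmetric] powr_powr mult.commute)
    then show ?thesis using nn[of 0] q by (simp add: powr_mult)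
  qed
  also have "B * 4 ^ j * (y 0 * q ^ j) * (y 0 powr \<beta> * (1 / 4) ^ j) = (B * y 0 powr \<beta>) * (y 0 * q ^ j)"
    by (simp add: power_one_over field_simps)
  also have "\<dots> \<le> q * (y 0 * q ^ j)" using small nn[of 0] q by (intro mult_right_mono) auto
  finally show ?case by (simp add: mult_ac)
qed simp

lemma bounded_if_level_energy:
  fixes u :: "'a::euclidean_space \<Rightarrow> real"
  assumes s: "s > 0" and um[measurable]: "u \<in> borel_measurable borel" and u0: "\<And>x. u x \<ge> 0"
    and u2: "integrable lborel (\<lambda>x. (u x)\<^sup>2)" and \<Lambda>: "\<Lambda> \<ge> 0"
    and key: "\<And>k. k \<ge> 0 \<Longrightarrow> nonlocal_energy s (\<lambda>x. max (u x - k) 0) \<le> ennreal (\<Lambda> * (\<integral>x. (u x)\<^sup>2 - (min (u x) k)\<^sup>2 \<partial>lborel))"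
  shows "\<exists>C. AE x in lborel. u x \<le> C"
proof -
  define n where "n = real DIM('a)"
  define V where "V = unit_ball_vol n"
  define \<delta> where "\<delta> = 2 * s / n"
  have n: "n > 0" by (simp add: n_def)
  have V: "V > 0" using n by (simp add: V_def)
  have \<delta>: "\<delta> > 0" using n s by (simp add: \<delta>_def)
  define S where "S = (\<integral>x. (u x)\<^sup>2 \<partial>lborel)"
  have S: "S \<ge> 0" by (simp add: S_def)
  define L where "L k = {x. u x > k}" for k
  have [measurable]: "L k \<in> sets borel" for k unfolding L_def by measurable
  define \<mu> where "\<mu> k = measure lborel (L k)" for k
  have Lfin: "emeasure lborel (L k) < \<infinity>" and Cheb: "k\<^sup>2 * \<mu> k \<le> S" if k: "k > 0" for k
  proof -
    have "(\<integral>\<^sup>+x. ennreal (k\<^sup>2) * indicator (L k) x \<partial>lborel) \<le> (\<integral>\<^sup>+x. ennreal ((u x)\<^sup>2) \<partial>lborel)"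
      using k by (intro nn_integral_mono) (auto simp: indicator_def L_def intro!: ennreal_leI power_mono)
    then have *: "ennreal (k\<^sup>2) * emeasure lborel (L k) \<le> ennreal S"
      using u2 by (simp add: nn_integral_cmult_indicator nn_integral_eq_integral S_def)
    show "emeasure lborel (L k) < \<infinity>"
    proof (rule ccontr)
      assume "\<not> emeasure lborel (L k) < \<infinity>"
      then have "emeasure lborel (L k) = top" by (simp add: less_top[symmetric])
      with * k show False by (simp add: ennreal_mult_top top_unique)
    qed
    then have "emeasure lborel (L k) = ennreal (\<mu> k)" by (simp add: \<mu>_def emeasure_eq_ennreal_measure less_top)
    with * S show "k\<^sup>2 * \<mu> k \<le> S" by (simp add: ennreal_mult[symmetric] \<mu>_def)
  qed
  have mono: "\<mu> h \<le> \<mu> k" if "0 < k" "k \<le> h" for h k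
    unfolding \<mu>_def using Lfin[of k] that
    by (intro measure_mono_fmeasurable) (auto simp: L_def fmeasurable_def)
  have \<mu>0: "\<mu> k \<ge> 0" for k by (simp add: \<mu>_def)
  \<comment> \<open>The Faber-Krahn constant for a support of measure a. It blows up as a tends to
    0, and \<open>a1\<close> is the threshold below which it is at least
    \<open>4 * \<Lambda>\<close>; the summand 1 added to \<Lambda> avoids a zero
    denominator.\<close>
  define c where "c a = V / 2 * (2 * a / V) powr (- \<delta>)" for a
  define a1 where "a1 = V / 2 * (V / (8 * (\<Lambda> + 1))) powr (1 / \<delta>)"
  have a1: "a1 > 0" using V \<Lambda> by (simp add: a1_def)
  have c_ge: "4 * \<Lambda> \<le> c a" and c_pos: "c a > 0" if a: "0 < a" "a \<le> a1" for a
  proof -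
    show "c a > 0" using a V by (simp add: c_def)
    have "2 * a / V \<le> (V / (8 * (\<Lambda> + 1))) powr (1 / \<delta>)" using a V by (simp add: a1_def field_simps)
    then have "(2 * a / V) powr \<delta> \<le> ((V / (8 * (\<Lambda> + 1))) powr (1 / \<delta>)) powr \<delta>"
      using a V \<delta> by (intro powr_mono2) auto
    also have "\<dots> = V / (8 * (\<Lambda> + 1))" using \<delta> V \<Lambda> by (simp add: powr_powr)
    finally have le: "(2 * a / V) powr \<delta> \<le> V / (8 * (\<Lambda> + 1))" .
    have pos: "(2 * a / V) powr \<delta> > 0" using a V by simp
    have "4 * \<Lambda> * (2 * a / V) powr \<delta> \<le> 4 * (\<Lambda> + 1) * (V / (8 * (\<Lambda> + 1)))"
      using le pos \<Lambda> by (intro mult_mono) auto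
    also have "\<dots> = V / 2" using \<Lambda> by (simp add: field_simps)
    finally show "4 * \<Lambda> \<le> c a" using pos by (simp add: c_def powr_minus divide_inverse[symmetric] pos_le_divide_eq)
  qed
  \<comment> \<open>The level estimate will contain 8 \<Lambda>^2 a / (c a)^2. Since
    \<open>c a\<close> is proportional to \<open>a powr (- \<delta>)\<close>, this is proportional
    to a^(1 + 2 \<delta>); \<open>D\<close> is the resulting constant.\<close>
  define \<beta> where "\<beta> = 2 * \<delta>"
  have \<beta>: "\<beta> > 0" using \<delta> by (simp add: \<beta>_def)
  define D where "D = 32 * \<Lambda>\<^sup>2 / V\<^sup>2 * (2 / V) powr \<beta>"
  have D: "D \<ge> 0" by (simp add: D_def)
  have ceq: "8 * \<Lambda>\<^sup>2 * a / (c a)\<^sup>2 = D * a * a powr \<beta>" if a: "0 < a" for a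
  proof -
    have "(2 * a / V) powr \<beta> = (2 / V) powr \<beta> * a powr \<beta>"
      using a V by (simp add: powr_mult[symmetric])
    moreover have "(c a)\<^sup>2 = V\<^sup>2 / 4 / (2 * a / V) powr \<beta>"
    proof -
      have "(2 * a / V) powr (- \<delta>) * (2 * a / V) powr (- \<delta>) = (2 * a / V) powr (- \<beta>)"
        unfolding powr_add[symmetric] by (simp add: \<beta>_def)
      then have "(c a)\<^sup>2 = V\<^sup>2 / 4 * (2 * a / V) powr (- \<beta>)"
        unfolding c_def power2_eq_square by (simp only: mult_ac times_divide_times_eq) simp
      then show ?thesis by (simp only: powr_minus divide_inverse)
    qed
    ultimately have "8 * \<Lambda>\<^sup>2 * a / (c a)\<^sup>2 = 8 * \<Lambda>\<^sup>2 * a / (V\<^sup>2 / 4 / ((2 / V) powr \<beta> * a powr \<beta>))" by (simp only:)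
    also have "\<dots> = D * a * a powr \<beta>" using a V by (simp add: D_def field_simps)
    finally show ?thesis .
  qed
  have step: "(h - k)\<^sup>2 * \<mu> h \<le> k\<^sup>2 * (D * \<mu> k * \<mu> k powr \<beta>)" if k: "0 < k" "k < h" and small: "\<mu> k \<le> a1" for k h
  proof (cases "\<mu> k = 0")
    case True
    with mono[of k h] \<mu>0[of h] k have "\<mu> h = 0" by simp
    then show ?thesis using True by simp
  next
    case False
    define a where "a = \<mu> k"
    have a: "0 < a" "a \<le> a1" using False \<mu>0[of k] small by (auto simp: a_def)
    define w where "w x = max (u x - k) 0" for x
    have [measurable]: "w \<in> borel_measurable borel" unfolding w_def by measurable
    have w2: "integrable lborel (\<lambda>x. (w x)\<^sup>2)"
      by (rule integrable_L2_dominated[OF _ u2]) (use k u0 in \<open>auto simp: w_def max_def\<close>)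
    define W where "W = (\<integral>x. (w x)\<^sup>2 \<partial>lborel)"
    have supp: "{x. w x \<noteq> 0} = L k" by (auto simp: w_def L_def max_def)
    have em: "emeasure lborel (L k) = ennreal a"
      using Lfin[of k] k by (simp add: a_def \<mu>_def emeasure_eq_ennreal_measure less_top)
    have Li: "integrable lborel (indicator (L k) :: 'a \<Rightarrow> real)"
      using Lfin[of k] k by (intro integrable_real_indicator) auto
    have v2: "integrable lborel (\<lambda>x. (min (u x) k)\<^sup>2)"
      by (rule integrable_L2_dominated[OF _ u2]) (use k u0 in auto)
    have cp: "c a > 0" and c4: "4 * \<Lambda> \<le> c a" using c_pos[OF a] c_ge[OF a] by auto
    have "ennreal (c a * W) = ennreal (c a) * (\<integral>\<^sup>+x. ennreal ((w x)\<^sup>2) \<partial>lborel)"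
      using w2 cp by (simp add: nn_integral_eq_integral W_def ennreal_mult)
    also have "\<dots> \<le> nonlocal_energy s w"
      using fractional_Faber_Krahn[of w a s] em supp a s by (simp add: c_def V_def n_def \<delta>_def)
    also have "\<dots> \<le> ennreal (\<Lambda> * (\<integral>x. (u x)\<^sup>2 - (min (u x) k)\<^sup>2 \<partial>lborel))"
      using key[of k] k by (simp add: w_def[abs_def])
    finally have 1: "c a * W \<le> \<Lambda> * (\<integral>x. (u x)\<^sup>2 - (min (u x) k)\<^sup>2 \<partial>lborel)"
    proof -
      assume *: "ennreal (c a * W) \<le> ennreal (\<Lambda> * (\<integral>x. (u x)\<^sup>2 - (min (u x) k)\<^sup>2 \<partial>lborel))"
      have "0 \<le> (\<integral>x. (u x)\<^sup>2 - (min (u x) k)\<^sup>2 \<partial>lborel)"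
        using u0 k by (intro Bochner_Integration.integral_nonneg) (auto simp: min_def)
      with * \<Lambda> show ?thesis by simp
    qed
    also have "\<dots> = (\<integral>x. \<Lambda> * ((u x)\<^sup>2 - (min (u x) k)\<^sup>2) \<partial>lborel)" by simp
    \<comment> \<open>Above level k the left integrand is \<Lambda> w^2 + 2 \<Lambda> k w. The first
      term costs a quarter of \<open>c a\<close> by the choice of \<open>a1\<close>, Young's
      inequality bounds the second by another quarter plus a constant, so half of
      \<open>c a * W\<close> survives on the left.\<close>
    also have "\<dots> \<le> (\<integral>x. c a / 2 * (w x)\<^sup>2 + 4 * \<Lambda>\<^sup>2 * k\<^sup>2 / c a * indicator (L k) x \<partial>lborel)"
    proof (rule integral_mono)
      fix x
      show "\<Lambda> * ((u x)\<^sup>2 - (min (u x) k)\<^sup>2) \<le> c a / 2 * (w x)\<^sup>2 + 4 * \<Lambda>\<^sup>2 * k\<^sup>2 / c a * indicator (L k) x"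
      proof (cases "u x > k")
        case True
        then have u: "u x = k + w x" by (simp add: w_def)
        have "0 \<le> (c a / 2 * w x - 2 * \<Lambda> * k)\<^sup>2 / c a" using cp by simp
        also have "\<dots> = c a / 4 * (w x)\<^sup>2 + 4 * \<Lambda>\<^sup>2 * k\<^sup>2 / c a - 2 * \<Lambda> * k * w x"
          using cp by (simp add: power2_eq_square field_simps)
        finally have "2 * \<Lambda> * k * w x \<le> c a / 4 * (w x)\<^sup>2 + 4 * \<Lambda>\<^sup>2 * k\<^sup>2 / c a" by simp
        moreover have "\<Lambda> * (w x)\<^sup>2 \<le> c a / 4 * (w x)\<^sup>2" using c4 by (intro mult_right_mono) auto
        moreover have "\<Lambda> * ((u x)\<^sup>2 - (min (u x) k)\<^sup>2) = \<Lambda> * (w x)\<^sup>2 + 2 * \<Lambda> * k * w x"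
          using True by (simp add: u power2_eq_square algebra_simps)
        moreover have "c a / 2 * (w x)\<^sup>2 = c a / 4 * (w x)\<^sup>2 + c a / 4 * (w x)\<^sup>2" by simp
        moreover have "indicator (L k) x = (1::real)" using True by (simp add: L_def)
        ultimately show ?thesis by simp
      next
        case False
        then show ?thesis using cp by (simp add: min_def L_def)
      qed
    qed (use u2 v2 w2 Li in auto)
    also have "\<dots> = c a / 2 * W + 4 * \<Lambda>\<^sup>2 * k\<^sup>2 / c a * a"
      using w2 Li by (simp add: W_def a_def \<mu>_def)
    finally have "c a / 2 * W \<le> 4 * \<Lambda>\<^sup>2 * k\<^sup>2 / c a * a" by simp
    then have "W \<le> k\<^sup>2 * (8 * \<Lambda>\<^sup>2 * a / (c a)\<^sup>2)" using cp by (simp add: field_simps power2_eq_square)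
    \<comment> \<open>Chebyshev: above the higher level h the function w is at least h - k.\<close>
    moreover have "(h - k)\<^sup>2 * \<mu> h \<le> W"
    proof -
      have Lh: "integrable lborel (indicator (L h) :: 'a \<Rightarrow> real)"
        using Lfin[of h] k by (intro integrable_real_indicator) auto
      have "(h - k)\<^sup>2 * \<mu> h = (\<integral>x. (h - k)\<^sup>2 * indicator (L h) x \<partial>lborel)" by (simp add: \<mu>_def)
      also have "\<dots> \<le> W" unfolding W_def
      proof (rule integral_mono)
        show "(h - k)\<^sup>2 * indicator (L h) x \<le> (w x)\<^sup>2" for x
          using k by (cases "x \<in> L h") (auto simp: L_def w_def intro!: power_mono)
      qed (use Lh w2 in auto)
      finally show ?thesis .
    qed
    ultimately show ?thesis unfolding ceq[OF a(1)] by (simp only: a_def)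
  qed
  define q where "q = (1 / 4 :: real) powr (1 / \<beta>)"
  have q: "0 < q" "q < 1" "q powr \<beta> = 1 / 4"
    using \<beta> powr_less_mono2[of "1 / \<beta>" "1 / 4" 1] by (simp_all add: q_def powr_powr)
  \<comment> \<open>The second bound on the initial measure makes 16 D y(0)^\<beta> at most q, the
    smallness condition of \<open>fast_geometric_decay\<close>; adding 1 avoids division by
    zero.\<close>
  define a2 where "a2 = min a1 ((q / (16 * D + 1)) powr (1 / \<beta>))"
  have a2: "a2 > 0" using a1 q D by (simp add: a2_def)
  \<comment> \<open>Chebyshev gives \<mu>(K) \<le> S / K^2, which is at most \<open>a2\<close> for
    this K; adding 1 keeps K positive even if S is 0.\<close>
  define K where "K = sqrt (S / a2) + 1"
  have K: "K > 0" using S a2 by (simp add: K_def add_nonneg_pos)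
  have "\<mu> K \<le> a2"
  proof -
    have "S / a2 \<le> K\<^sup>2" using S a2 by (simp add: K_def power2_sum)
    then have "S \<le> a2 * K\<^sup>2" using a2 by (simp add: field_simps)
    with Cheb[OF K] have "K\<^sup>2 * \<mu> K \<le> K\<^sup>2 * a2" by (simp add: mult.commute)
    then show ?thesis using K by simp
  qed
  \<comment> \<open>The levels increase from K to 2K with gaps K (1/2)^(j+1). The ratio (2K)^2 / (K
    (1/2)^(j+1))^2 = 16 * 4^j produces the factor \<open>16 * D * 4 ^ j\<close>; K cancels, so it
    could be chosen after all the constants.\<close>
  define y where "y j = \<mu> (K * (2 - (1/2) ^ j))" for j :: nat
  have y0: "y 0 \<le> a2" using \<open>\<mu> K \<le> a2\<close> by (simp add: y_def)
  have "y j \<le> y 0 * q ^ j" for j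
  proof (rule fast_geometric_decay[where B = "16 * D" and \<beta> = \<beta>])
    show "16 * D * y 0 powr \<beta> \<le> q"
    proof -
      have "y 0 powr \<beta> \<le> ((q / (16 * D + 1)) powr (1 / \<beta>)) powr \<beta>"
        using y0 \<mu>0 \<beta> by (intro powr_mono2) (auto simp: a2_def y_def)
      also have "\<dots> = q / (16 * D + 1)" using \<beta> q D by (simp add: powr_powr)
      finally have "16 * D * y 0 powr \<beta> \<le> (16 * D + 1) * (q / (16 * D + 1))"
        using D by (intro mult_mono) auto
      then show ?thesis using D by simp
    qed
    fix j assume "y j \<le> y 0"
    then have yj: "y j \<le> a1" using y0 by (simp add: a2_def)
    let ?k = "K * (2 - (1/2) ^ j)" and ?h = "K * (2 - (1/2) ^ Suc j)"
    have e: "0 < (1/2 :: real) ^ j" "(1/2 :: real) ^ j \<le> 1" by (auto simp: power_le_one)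
    have "0 < ?k" "?k < ?h" using K e by (auto intro!: mult_pos_pos)
    from step[OF this] yj have "(?h - ?k)\<^sup>2 * y (Suc j) \<le> ?k\<^sup>2 * (D * y j * y j powr \<beta>)"
      by (simp add: y_def)
    also have "\<dots> \<le> (2 * K)\<^sup>2 * (D * y j * y j powr \<beta>)"
      using K e D \<mu>0 by (intro mult_right_mono power_mono) (auto simp: y_def)
    also have "?h - ?k = K * (1/2) ^ Suc j" by (simp add: algebra_simps)
    finally have "(K * (1/2) ^ Suc j)\<^sup>2 * y (Suc j) \<le> (2 * K)\<^sup>2 * (D * y j * y j powr \<beta>)" .
    moreover have "(K * (1/2) ^ Suc j)\<^sup>2 = K\<^sup>2 / (4 * 4 ^ j)"
      by (simp add: power_mult_distrib power_one_over power2_eq_square field_simps flip: power_mult_distrib)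
    ultimately have "K\<^sup>2 / (4 * 4 ^ j) * y (Suc j) \<le> K\<^sup>2 * (4 * (D * y j * y j powr \<beta>))"
      by (simp add: power_mult_distrib mult_ac)
    then have "y (Suc j) / (4 * 4 ^ j) \<le> 4 * (D * y j * y j powr \<beta>)"
      using K mult_le_cancel_left_pos[of "K\<^sup>2" "y (Suc j) / (4 * 4 ^ j)"] by simp
    then show "y (Suc j) \<le> 16 * D * 4 ^ j * y j * y j powr \<beta>"
      by (simp add: field_simps)
  qed (use \<mu>0 D q \<beta> in \<open>auto simp: y_def\<close>)
  moreover have "\<mu> (2 * K) \<le> y j" for j
    unfolding y_def
  proof (rule mono)
    have "0 < (1/2 :: real) ^ j" "(1/2 :: real) ^ j \<le> 1" by (auto simp: power_le_one)
    then show "0 < K * (2 - (1/2) ^ j)" "K * (2 - (1/2) ^ j) \<le> 2 * K"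
      using K by (auto intro!: mult_pos_pos simp: algebra_simps)
  qed
  ultimately have "\<mu> (2 * K) \<le> y 0 * q ^ j" for j by (meson order_trans)
  moreover have "(\<lambda>j. y 0 * q ^ j) \<longlonglongrightarrow> y 0 * 0"
    using q by (intro tendsto_mult tendsto_const LIMSEQ_power_zero) auto
  ultimately have "\<mu> (2 * K) \<le> 0" by (intro LIMSEQ_le_const[of _ 0]) auto
  with \<mu>0 have "\<mu> (2 * K) = 0" by (simp add: antisym)
  then have "emeasure lborel (L (2 * K)) = 0"
    using Lfin[of "2 * K"] K by (simp add: \<mu>_def emeasure_eq_ennreal_measure less_top)
  then have "AE x in lborel. x \<notin> L (2 * K)"
    by (intro AE_not_in) (auto simp: null_sets_def)
  then show ?thesis by (auto simp: L_def not_less)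
qed

section \<open>The minimiser compared with its truncations\<close>

lemma Denergy_cong_AE:
  assumes eq: "AE x in lebesgue. u x = u' x"
    and m: "u \<in> borel_measurable lebesgue" "u' \<in> borel_measurable lebesgue"
  shows "Denergy \<Omega> s u = Denergy \<Omega> s u'"
proof -
  have "wgrad u = wgrad u'" using L2_grad_cong_AE[OF assms] by (simp add: wgrad_def)
  moreover have "(\<integral>\<^sup>+ x. \<integral>\<^sup>+ y. ennreal ((u x - u y)\<^sup>2 / dist x y powr p) \<partial>lebesgue \<partial>lebesgue) =
     (\<integral>\<^sup>+ x. \<integral>\<^sup>+ y. ennreal ((u' x - u' y)\<^sup>2 / dist x y powr p) \<partial>lebesgue \<partial>lebesgue)" for p
  proof (rule nn_integral_cong_AE)
    show "AE x in lebesgue. (\<integral>\<^sup>+ y. ennreal ((u x - u y)\<^sup>2 / dist x y powr p) \<partial>lebesgue) =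
       (\<integral>\<^sup>+ y. ennreal ((u' x - u' y)\<^sup>2 / dist x y powr p) \<partial>lebesgue)"
      using eq
    proof eventually_elim
      case (elim x)
      show ?case by (rule nn_integral_cong_AE) (use eq in \<open>eventually_elim, simp add: elim\<close>)
    qed
  qed
  ultimately show ?thesis by (simp add: Denergy_def)
qed

lemma L2sq_on_eq_integral:
  assumes "AE x in lebesgue. x \<notin> \<Omega> \<longrightarrow> u x = 0" "u \<in> borel_measurable lebesgue" "\<Omega> \<in> sets lebesgue"
  shows "L2sq_on \<Omega> u = (\<integral>x. (u x)\<^sup>2 \<partial>lebesgue)"
  unfolding L2sq_on_def
proof (rule integral_cong_AE)
  show "AE x in lebesgue. indicator \<Omega> x * (u x)\<^sup>2 = (u x)\<^sup>2"
    using assms(1) by eventually_elim (auto simp: indicator_def)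
qed (use assms in measurable)

text \<open>The multiplied form of the infimum also covers the zero function, which the quotient
  excludes and which occurs as the truncation at level 0.\<close>

lemma lambdaL_mult_L2sq_le_Denergy:
  assumes "u \<in> XOmega \<Omega>" "\<Omega> \<in> sets lebesgue"
  shows "lambdaL \<Omega> s * ennreal (L2sq_on \<Omega> u) \<le> Denergy \<Omega> s u"
proof -
  have um: "u \<in> borel_measurable lebesgue" and u2: "integrable lebesgue (\<lambda>x. (u x)\<^sup>2)"
    and out: "AE x in lebesgue. x \<notin> \<Omega> \<longrightarrow> u x = 0"
    using assms by (auto simp: XOmega_def H1_def)
  have L: "L2sq_on \<Omega> u = (\<integral>x. (u x)\<^sup>2 \<partial>lebesgue)" by (rule L2sq_on_eq_integral[OF out um assms(2)])
  show ?thesis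
  proof (cases "AE x in lebesgue. u x = 0")
    case True
    then have "L2sq_on \<Omega> u = 0" unfolding L
      using integral_nonneg_eq_0_iff_AE[OF u2] by simp
    then show ?thesis by simp
  next
    case False
    then have "L2sq_on \<Omega> u \<noteq> 0" unfolding L
      using integral_nonneg_eq_0_iff_AE[OF u2] by simp
    moreover have "L2sq_on \<Omega> u \<ge> 0" unfolding L by simp
    ultimately have pos: "L2sq_on \<Omega> u > 0" by simp
    have "lambdaL \<Omega> s \<le> Denergy \<Omega> s u / ennreal (L2sq_on \<Omega> u)"
      unfolding lambdaL_def by (rule INF_lower) (use assms False in auto)
    then have "lambdaL \<Omega> s * ennreal (L2sq_on \<Omega> u) \<le> Denergy \<Omega> s u / ennreal (L2sq_on \<Omega> u) * ennreal (L2sq_on \<Omega> u)"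
      by (rule mult_right_mono) simp
    also have "\<dots> = Denergy \<Omega> s u"
      using pos by (simp add: ennreal_divide_times ennreal_divide_self)
    finally show ?thesis .
  qed
qed

lemma minimizer_level_energy:
  fixes \<Omega> :: "'a::euclidean_space set"
  assumes um: "u \<in> borel_measurable borel" and u: "principal_eigenfunction \<Omega> s u" and u0: "\<And>x. u x \<ge> 0"
    and fin: "lambdaL \<Omega> s = ennreal \<Lambda>" "\<Lambda> \<ge> 0" and \<Omega>: "\<Omega> \<in> sets lebesgue" and k: "k \<ge> 0"
  shows "nonlocal_energy s (\<lambda>x. max (u x - k) 0) \<le> ennreal (\<Lambda> * (\<integral>x. (u x)\<^sup>2 - (min (u x) k)\<^sup>2 \<partial>lborel))"
proof -
  let ?v = "\<lambda>x. min (u x) k" and ?w = "\<lambda>x. max (u x - k) 0"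
  note [measurable] = um
  from u have X: "u \<in> XOmega \<Omega>" and L1: "L2sq_on \<Omega> u = 1" and E: "Denergy \<Omega> s u = lambdaL \<Omega> s"
    by (auto simp: principal_eigenfunction_def)
  have H: "u \<in> H1" and out: "AE x in lebesgue. x \<notin> \<Omega> \<longrightarrow> u x = 0" using X by (auto simp: XOmega_def)
  have uL: "u \<in> borel_measurable lebesgue" "?v \<in> borel_measurable lebesgue"
    by (auto intro!: measurable_completion)
  have outv: "AE x in lebesgue. x \<notin> \<Omega> \<longrightarrow> ?v x = 0" using out by eventually_elim (use k in auto)
  have Xv: "?v \<in> XOmega \<Omega>" using min_in_H1(1)[OF H k] outv by (simp add: XOmega_def)
  have u2: "integrable lborel (\<lambda>x. (u x)\<^sup>2)" using H by (simp add: H1_def integrable_completion)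
  have v2: "integrable lborel (\<lambda>x. (?v x)\<^sup>2)"
    by (rule integrable_L2_dominated[OF _ u2]) (use k u0 in auto)
  have Lu: "(\<integral>x. (u x)\<^sup>2 \<partial>lborel) = 1"
    using L1 L2sq_on_eq_integral[OF out uL(1) \<Omega>] by (simp add: integral_completion)
  have Lv: "L2sq_on \<Omega> ?v = (\<integral>x. (?v x)\<^sup>2 \<partial>lborel)"
    using L2sq_on_eq_integral[OF outv uL(2) \<Omega>] by (simp add: integral_completion)
  define G where "G f = (\<integral>\<^sup>+ x. indicator \<Omega> x * ennreal ((norm (wgrad f x))\<^sup>2) \<partial>lebesgue)" for f :: "'a \<Rightarrow> real"
  have D: "Denergy \<Omega> s f = G f + nonlocal_energy s f" for f
    by (simp add: Denergy_def G_def nonlocal_energy_def nn_integral_completion)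
  have "G ?v \<le> G u" unfolding G_def
  proof (rule nn_integral_mono_AE)
    show "AE x in lebesgue. indicator \<Omega> x * ennreal ((norm (wgrad ?v x))\<^sup>2) \<le> indicator \<Omega> x * ennreal ((norm (wgrad u x))\<^sup>2)"
      using min_in_H1(2)[OF H k]
      by eventually_elim (auto intro!: mult_left_mono ennreal_leI power_mono)
  qed
  have v1: "(\<integral>x. (?v x)\<^sup>2 \<partial>lborel) \<le> 1"
    unfolding Lu[symmetric] by (rule integral_mono[OF v2 u2]) (use k u0 in \<open>auto intro!: power_mono\<close>)
  \<comment> \<open>Subtraction is avoided by carrying the energy of \<open>?w\<close> on the left
    and splitting \<Lambda> on the right, which is possible because the truncation has norm at most
    one. The common summand is finite and cancels at the end.\<close>
  have "ennreal (\<Lambda> * (\<integral>x. (?v x)\<^sup>2 \<partial>lborel)) + nonlocal_energy s ?w =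
      lambdaL \<Omega> s * ennreal (L2sq_on \<Omega> ?v) + nonlocal_energy s ?w"
    using fin(2) by (simp add: fin(1) Lv ennreal_mult)
  also have "\<dots> \<le> Denergy \<Omega> s ?v + nonlocal_energy s ?w"
    by (intro add_right_mono lambdaL_mult_L2sq_le_Denergy Xv \<Omega>)
  also have "\<dots> = G ?v + (nonlocal_energy s ?v + nonlocal_energy s ?w)" by (simp add: D add.assoc)
  also have "\<dots> \<le> G u + nonlocal_energy s u"
    by (intro add_mono nonlocal_energy_split um) fact
  also have "\<dots> = ennreal \<Lambda>" using E fin by (simp add: D)
  also have "\<dots> = ennreal (\<Lambda> * (\<integral>x. (?v x)\<^sup>2 \<partial>lborel)) + ennreal (\<Lambda> * (1 - (\<integral>x. (?v x)\<^sup>2 \<partial>lborel)))"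
    using fin(2) v1 by (subst ennreal_plus[symmetric]) (auto simp: algebra_simps mult_left_le simp del: ennreal_plus)
  finally have "nonlocal_energy s ?w \<le> ennreal (\<Lambda> * (1 - (\<integral>x. (?v x)\<^sup>2 \<partial>lborel)))"
    by simp
  then show ?thesis using u2 v2 by (simp add: Lu)
qed

theorem theorem3p5:
  fixes \<Omega> :: "'a::euclidean_space set" and s :: real and u0 :: "'a \<Rightarrow> real"
  assumes "0 < s" "s < 1"
    and "open \<Omega>" "bounded \<Omega>" "C1_boundary \<Omega>"
    and "principal_eigenfunction \<Omega> s u0"
  shows "\<exists>C. AE x in lebesgue. x \<in> \<Omega> \<longrightarrow> \<bar>u0 x\<bar> \<le> C"
proof -
  from assms(6) have X: "u0 \<in> XOmega \<Omega>" and L1: "L2sq_on \<Omega> u0 = 1" and E: "Denergy \<Omega> s u0 = lambdaL \<Omega> s"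
    and nn: "AE x in lebesgue. x \<in> \<Omega> \<longrightarrow> u0 x \<ge> 0"
    by (auto simp: principal_eigenfunction_def)
  have H: "u0 \<in> H1" and out: "AE x in lebesgue. x \<notin> \<Omega> \<longrightarrow> u0 x = 0" using X by (auto simp: XOmega_def)
  have m: "u0 \<in> borel_measurable lebesgue" and u2: "integrable lebesgue (\<lambda>x. (u0 x)\<^sup>2)" using H by (auto simp: H1_def)
  have \<Omega>: "\<Omega> \<in> sets lebesgue" using assms(3) by auto
  obtain u' where u': "u' \<in> borel_measurable borel" and ae: "AE x in lborel. u0 x = u' x"
    using completion_ex_borel_measurable_real[OF m] by auto
  \<comment> \<open>The eigenfunction is nonnegative almost everywhere in the domain and zero almost
    everywhere outside, so taking the positive part of a Borel representative changes it only on a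
    null set and yields nonnegativity at every point.\<close>
  define u where "u x = max (u' x) 0" for x
  have um[measurable]: "u \<in> borel_measurable borel" using u' by (simp add: u_def[abs_def])
  have uL: "u \<in> borel_measurable lebesgue" by (simp add: measurable_completion)
  have eq: "AE x in lebesgue. u0 x = u x"
    using AE_completion[OF ae] nn out by eventually_elim (auto simp: u_def)
  have "u \<in> H1"
  proof -
    have "integrable lebesgue (\<lambda>x. (u x)\<^sup>2)"
      using u2 by (rule integrable_cong_AE_imp) (use eq uL m in auto)
    moreover have "L2_grad u (wgrad u0)" using L2_grad_wgrad[OF H] L2_grad_cong_AE[OF eq m uL] by simp
    ultimately show ?thesis using uL by (auto simp: H1_def)
  qed
  moreover have outu: "AE x in lebesgue. x \<notin> \<Omega> \<longrightarrow> u x = 0" using out eq by eventually_elim auto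
  moreover have "L2sq_on \<Omega> u = 1"
  proof -
    have "(\<integral>x. (u x)\<^sup>2 \<partial>lebesgue) = (\<integral>x. (u0 x)\<^sup>2 \<partial>lebesgue)"
      by (rule integral_cong_AE) (use eq uL m in auto)
    then show ?thesis using L1 L2sq_on_eq_integral[OF out m \<Omega>] L2sq_on_eq_integral[OF outu uL \<Omega>] by simp
  qed
  moreover have "Denergy \<Omega> s u = lambdaL \<Omega> s" using Denergy_cong_AE[OF eq m uL] E by simp
  ultimately have pe: "principal_eigenfunction \<Omega> s u"
    by (auto simp: principal_eigenfunction_def XOmega_def u_def)
  \<comment> \<open>The normalisation rules out an empty domain, for which there would be no
    competitor and the infimum would be infinite.\<close>
  have "\<Omega> \<noteq> {}" using L1 by (auto simp: L2sq_on_def)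
  then have "lambdaL \<Omega> s < \<infinity>" using lambdaL_finite assms by blast
  then obtain \<Lambda> where \<Lambda>: "lambdaL \<Omega> s = ennreal \<Lambda>" "\<Lambda> \<ge> 0"
    by (cases "lambdaL \<Omega> s") auto
  have "\<exists>C. AE x in lborel. u x \<le> C"
  proof (rule bounded_if_level_energy[OF assms(1) um _ _ \<Lambda>(2)])
    show "integrable lborel (\<lambda>x. (u x)\<^sup>2)" using \<open>u \<in> H1\<close> by (simp add: H1_def integrable_completion)
    show "nonlocal_energy s (\<lambda>x. max (u x - k) 0) \<le> ennreal (\<Lambda> * (\<integral>x. (u x)\<^sup>2 - (min (u x) k)\<^sup>2 \<partial>lborel))"
      if "k \<ge> 0" for k
      by (rule minimizer_level_energy[OF um pe _ \<Lambda> \<Omega> that]) (simp add: u_def)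
  qed (simp add: u_def)
  then obtain C where "AE x in lborel. u x \<le> C" by blast
  then have "AE x in lebesgue. u x \<le> C" by (rule AE_completion)
  then have "AE x in lebesgue. x \<in> \<Omega> \<longrightarrow> \<bar>u0 x\<bar> \<le> C"
    using eq by eventually_elim (auto simp: u_def)
  then show ?thesis by blast
qed

end
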